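(* Let $\varphi$ be an analytic self-map of $\mathbb{D}$ and $\psi$ an analytic function on $\mathbb{D}$. The weighted composition operator $C_{\psi,\varphi}$ on $H^2$ is both an isometry and a complex symmetric operator if and only if there are $p\in\mathbb{D}$ and $\lambda,c\in\mathbb{C}$ with $|\lambda|=|c|=1$ such that $\varphi(z)=\lambda\frac{p-z}{1-\overline{p}z}$ and $\psi(z)=\psi_p(z)=c\frac{(1-|p|^2)^{1/2}}{1-\overline{p}z}$. Furthermore, if $p\neq 0$, then $C_{\psi,\varphi}$ is complex symmetric with conjugation $C_{\psi_p,\varphi_p}J$, where $\varphi_p(z)=\frac{\overline{p}}{p}\frac{p-z}{1-\overline{p}z}$.
   Context: $\mathbb{D}$ is the open unit disk and $H^2$ is the Hardy space on $\mathbb{D}$. For $\psi$ analytic on $\mathbb{D}$ and $\varphi$ an analytic self-map of $\mathbb{D}$, $(C_{\psi,\varphi}f)(z)=\psi(z)f(\varphi(z))$. A conjugation is an isometric, antilinear involution $C$ on a complex Hilbert space; a bounded operator $T$ is complex symmetric with conjugation $C$ if $CT^*C=T$, and complex symmetric if this holds for some conjugation $C$. $J$ is the conjugation on $H^2$ given by $(Jf)(z)=\overline{f(\overline{z})}$. *)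

theory Defs
  imports "HOL-Complex_Analysis.Complex_Analysis"
begin

abbreviation unit_disk :: "complex set"
  where "unit_disk \<equiv> ball 0 1"

definition taylor_coeff :: "(complex \<Rightarrow> complex) \<Rightarrow> nat \<Rightarrow> complex"
  where "taylor_coeff f n = (deriv ^^ n) f 0 / fact n"

text \<open>An element of the Hardy space is a function on the open unit disk. It is represented by its
  extension by zero to the whole plane, so that equality of elements is equality in HOL.\<close>

definition H2 :: "(complex \<Rightarrow> complex) set"
  where "H2 = {f. f holomorphic_on unit_disk \<and> (\<forall>z. z \<notin> unit_disk \<longrightarrow> f z = 0) \<and>
                  summable (\<lambda>n. (cmod (taylor_coeff f n))\<^sup>2)}"

definition H2_inner :: "(complex \<Rightarrow> complex) \<Rightarrow> (complex \<Rightarrow> complex) \<Rightarrow> complex"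
  where "H2_inner f g = (\<Sum>n. taylor_coeff f n * cnj (taylor_coeff g n))"

definition H2_norm :: "(complex \<Rightarrow> complex) \<Rightarrow> real"
  where "H2_norm f = sqrt (\<Sum>n. (cmod (taylor_coeff f n))\<^sup>2)"

text \<open>Operators on the Hardy space are functions that are only considered on \<open>H2\<close>;
  their values elsewhere are irrelevant.\<close>

type_synonym H2_op = "(complex \<Rightarrow> complex) \<Rightarrow> (complex \<Rightarrow> complex)"

definition H2_bounded_operator :: "H2_op \<Rightarrow> bool"
  where "H2_bounded_operator T \<longleftrightarrow>
    T \<in> H2 \<rightarrow> H2 \<and>
    (\<forall>f\<in>H2. \<forall>g\<in>H2. T (\<lambda>z. f z + g z) = (\<lambda>z. T f z + T g z)) \<and>
    (\<forall>a. \<forall>f\<in>H2. T (\<lambda>z. a * f z) = (\<lambda>z. a * T f z)) \<and>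
    (\<exists>M. \<forall>f\<in>H2. H2_norm (T f) \<le> M * H2_norm f)"

definition H2_isometry :: "H2_op \<Rightarrow> bool"
  where "H2_isometry T \<longleftrightarrow>
    H2_bounded_operator T \<and> (\<forall>f\<in>H2. H2_norm (T f) = H2_norm f)"

text \<open>The adjoint of a bounded operator; as an operator on \<open>H2\<close> it exists and is unique
  (only its values outside \<open>H2\<close> are left to the choice operator).\<close>

definition H2_adjoint :: "H2_op \<Rightarrow> H2_op"
  where "H2_adjoint T =
    (SOME S. S \<in> H2 \<rightarrow> H2 \<and> (\<forall>f\<in>H2. \<forall>g\<in>H2. H2_inner (T f) g = H2_inner f (S g)))"

definition H2_conjugation :: "H2_op \<Rightarrow> bool"
  where "H2_conjugation C \<longleftrightarrow>
    C \<in> H2 \<rightarrow> H2 \<and>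
    (\<forall>f\<in>H2. \<forall>g\<in>H2. C (\<lambda>z. f z + g z) = (\<lambda>z. C f z + C g z)) \<and>
    (\<forall>a. \<forall>f\<in>H2. C (\<lambda>z. a * f z) = (\<lambda>z. cnj a * C f z)) \<and>
    (\<forall>f\<in>H2. H2_norm (C f) = H2_norm f) \<and>
    (\<forall>f\<in>H2. C (C f) = f)"

definition complex_symmetric_with :: "H2_op \<Rightarrow> H2_op \<Rightarrow> bool"
  where "complex_symmetric_with T C \<longleftrightarrow>
    H2_bounded_operator T \<and> H2_conjugation C \<and>
    (\<forall>f\<in>H2. C (H2_adjoint T (C f)) = T f)"

definition complex_symmetric :: "H2_op \<Rightarrow> bool"
  where "complex_symmetric T \<longleftrightarrow> (\<exists>C. complex_symmetric_with T C)"

definition weighted_comp :: "(complex \<Rightarrow> complex) \<Rightarrow> (complex \<Rightarrow> complex) \<Rightarrow> H2_op"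
  where "weighted_comp \<psi> \<phi> f = (\<lambda>z. if z \<in> unit_disk then \<psi> z * f (\<phi> z) else 0)"

definition J :: H2_op
  where "J f = (\<lambda>z. cnj (f (cnj z)))"

definition psi_p :: "complex \<Rightarrow> complex \<Rightarrow> complex \<Rightarrow> complex"
  where "psi_p c p z = c * (complex_of_real (sqrt (1 - (cmod p)\<^sup>2)) / (1 - cnj p * z))"

definition phi_p :: "complex \<Rightarrow> complex \<Rightarrow> complex"
  where "phi_p p z = cnj p / p * ((p - z) / (1 - cnj p * z))"

end

theory Submission
  imports Defs
begin

text \<open>
  If \<open>T = C\<^bsub>\<psi>,\<phi>\<^esub>\<close> is an isometry with \<open>C T\<^sup>* C = T\<close>, then \<open>T\<^sup>* = C T C\<close> preserves inner products. Evaluating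
  this on Szego kernels gives \<open>\<psi>(z) \<psi>(w)\<^sup>- / (1 - \<phi>(w)\<^sup>- \<phi>(z)) = 1 / (1 - w\<^sup>- z)\<close>, where \<open>x\<^sup>-\<close> is the complex
  conjugate. Setting \<open>w = 0\<close> expresses \<open>\<psi>\<close> through \<open>\<phi>\<close>, and then
  \<open>\<sigma> = (\<phi> - a) / (1 - a\<^sup>- \<phi>)\<close> with \<open>a = \<phi>(0)\<close> satisfies \<open>\<sigma>(w)\<^sup>- \<sigma>(z) = w\<^sup>- z\<close>, so that \<open>\<sigma>\<close> is a rotation.

  Conversely, multiplication by the Blaschke factor \<open>\<phi>\<close> is isometric and its range is orthogonal to the
  kernel at \<open>p\<close>, a multiple of \<open>\<psi>\<close>; hence the functions \<open>\<psi> \<phi>\<^sup>n\<close> are orthonormal and \<open>T\<close> is a contraction.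
  Its inverse has the same form, so \<open>T\<close> is unitary, and \<open>C T\<^sup>* C = T\<close> amounts to \<open>(C T)\<^sup>2 = 1\<close>. For
  \<open>C = C\<^bsub>\<psi>\<^sub>p,\<phi>\<^sub>p\<^esub> J\<close> the operator \<open>C T\<close> is \<open>J\<close> composed with a rotation.
\<close>

section \<open>Taylor coefficients on the unit disk\<close>

lemma taylor_coeff_sums:
  assumes "f holomorphic_on unit_disk" "z \<in> unit_disk"
  shows "(\<lambda>n. taylor_coeff f n * z ^ n) sums f z"
  using holomorphic_power_series[OF assms] by (simp add: taylor_coeff_def)

lemma sums_imp_holomorphic:
  assumes "\<And>z. z \<in> unit_disk \<Longrightarrow> (\<lambda>n. a n * z ^ n) sums f z"
  shows "f holomorphic_on unit_disk"
  by (rule power_series_holomorphic[of 0 1 a]) (use assms in auto)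

text \<open>Power series expansions at 0 are unique. Explicit Taylor coefficients are found below by
  exhibiting a convergent series instead of differentiating.\<close>

lemma sums_imp_taylor_coeff:
  assumes "\<And>z. z \<in> unit_disk \<Longrightarrow> (\<lambda>n. a n * z ^ n) sums f z"
  shows "taylor_coeff f = a"
proof -
  have "eventually (\<lambda>z. z \<in> unit_disk) (nhds (0::complex))"
    by (intro eventually_nhds_in_open) auto
  then have "f has_fps_expansion Abs_fps a"
    by (intro has_fps_expansionI) (auto elim!: eventually_mono simp: assms)
  from fps_nth_fps_expansion[OF this] show ?thesis
    by (auto simp: taylor_coeff_def fun_eq_iff)
qed

lemma taylor_coeff_cong:
  assumes "\<And>z. z \<in> unit_disk \<Longrightarrow> f z = g z"
  shows "taylor_coeff f = taylor_coeff g"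
proof -
  have "eventually (\<lambda>z. f z = g z) (nhds (0::complex))"
    by (rule eventually_mono[OF eventually_nhds_in_open[of unit_disk]]) (use assms in auto)
  then have "(deriv ^^ n) f 0 = (deriv ^^ n) g 0" for n
    by (rule higher_deriv_cong_ev) simp
  then show ?thesis by (simp add: taylor_coeff_def fun_eq_iff)
qed

lemma taylor_coeff_add:
  assumes "f holomorphic_on unit_disk" "g holomorphic_on unit_disk"
  shows "taylor_coeff (\<lambda>z. f z + g z) = (\<lambda>n. taylor_coeff f n + taylor_coeff g n)"
  using sums_add[OF taylor_coeff_sums[OF assms(1)] taylor_coeff_sums[OF assms(2)]]
  by (intro sums_imp_taylor_coeff) (simp add: ring_distribs)

lemma taylor_coeff_diff:
  assumes "f holomorphic_on unit_disk" "g holomorphic_on unit_disk"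
  shows "taylor_coeff (\<lambda>z. f z - g z) = (\<lambda>n. taylor_coeff f n - taylor_coeff g n)"
  using sums_diff[OF taylor_coeff_sums[OF assms(1)] taylor_coeff_sums[OF assms(2)]]
  by (intro sums_imp_taylor_coeff) (simp add: ring_distribs)

lemma taylor_coeff_cmult:
  assumes "f holomorphic_on unit_disk"
  shows "taylor_coeff (\<lambda>z. c * f z) = (\<lambda>n. c * taylor_coeff f n)"
  using sums_mult[OF taylor_coeff_sums[OF assms], of _ c]
  by (intro sums_imp_taylor_coeff) (simp add: mult.assoc)

lemma taylor_coeff_mult_id:
  assumes "f holomorphic_on unit_disk"
  shows "taylor_coeff (\<lambda>z. z * f z) = case_nat 0 (taylor_coeff f)"
proof (rule sums_imp_taylor_coeff)
  fix z :: complex assume "z \<in> unit_disk"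
  from sums_mult[OF taylor_coeff_sums[OF assms this], of z]
  have "(\<lambda>n. case_nat 0 (taylor_coeff f) (Suc n) * z ^ Suc n) sums (z * f z)"
    by (simp add: mult_ac)
  from sums_Suc[OF this] show "(\<lambda>n. case_nat 0 (taylor_coeff f) n * z ^ n) sums (z * f z)"
    by simp
qed

lemma J_sums:
  assumes "f holomorphic_on unit_disk" "z \<in> unit_disk"
  shows "(\<lambda>n. cnj (taylor_coeff f n) * z ^ n) sums J f z"
proof -
  have "(\<lambda>n. cnj (taylor_coeff f n * cnj z ^ n)) sums cnj (f (cnj z))"
    using taylor_coeff_sums[OF assms(1), of "cnj z"] assms(2) by (subst sums_cnj) simp
  then show ?thesis by (simp add: J_def)
qed

lemma taylor_coeff_J:
  assumes "f holomorphic_on unit_disk"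
  shows "taylor_coeff (J f) = (\<lambda>n. cnj (taylor_coeff f n))"
  using J_sums[OF assms] by (rule sums_imp_taylor_coeff)

section \<open>The inner product of the Hardy space\<close>

text \<open>Membership in \<open>H2\<close> apart from the convention of vanishing off the disk.
  Kernels, Blaschke factors and their products are formulas that do not vanish there, so the inner
  product calculus is set up for this larger class.\<close>

definition hardy :: "(complex \<Rightarrow> complex) \<Rightarrow> bool"
  where "hardy f \<longleftrightarrow> f holomorphic_on unit_disk \<and> summable (\<lambda>n. (cmod (taylor_coeff f n))\<^sup>2)"

lemma H2_iff: "f \<in> H2 \<longleftrightarrow> hardy f \<and> (\<forall>z. z \<notin> unit_disk \<longrightarrow> f z = 0)"
  by (auto simp: H2_def hardy_def)

lemma hardyD1: "hardy f \<Longrightarrow> f holomorphic_on unit_disk"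
  and hardyD2: "hardy f \<Longrightarrow> summable (\<lambda>n. (cmod (taylor_coeff f n))\<^sup>2)"
  by (auto simp: hardy_def)

lemma H2_hardy: "f \<in> H2 \<Longrightarrow> hardy f"
  by (simp add: H2_iff)

lemma hardy_cong:
  assumes "\<And>z. z \<in> unit_disk \<Longrightarrow> f z = g z"
  shows "hardy f \<longleftrightarrow> hardy g"
proof -
  have "taylor_coeff f = taylor_coeff g" using assms by (rule taylor_coeff_cong)
  moreover have "f holomorphic_on unit_disk \<longleftrightarrow> g holomorphic_on unit_disk"
    using assms by (intro holomorphic_cong) auto
  ultimately show ?thesis by (simp add: hardy_def)
qed

lemma H2_norm_cong:
  assumes "\<And>z. z \<in> unit_disk \<Longrightarrow> f z = g z"
  shows "H2_norm f = H2_norm g"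
proof -
  have "taylor_coeff f = taylor_coeff g" using assms by (rule taylor_coeff_cong)
  then show ?thesis by (simp add: H2_norm_def)
qed

lemma summable_inner:
  fixes a b :: "nat \<Rightarrow> complex"
  assumes "summable (\<lambda>n. (cmod (a n))\<^sup>2)" "summable (\<lambda>n. (cmod (b n))\<^sup>2)"
  shows "summable (\<lambda>n. cmod (a n) * cmod (b n))"
proof (rule summable_comparison_test[OF _ summable_add[OF assms]])
  have "cmod (a n) * cmod (b n) \<le> (cmod (a n))\<^sup>2 + (cmod (b n))\<^sup>2" for n
    using sum_squares_bound[of "cmod (a n)" "cmod (b n)"]
      mult_nonneg_nonneg[OF norm_ge_zero[of "a n"] norm_ge_zero[of "b n"]] by linarith
  then show "\<exists>N. \<forall>n\<ge>N. norm (cmod (a n) * cmod (b n)) \<le> (cmod (a n))\<^sup>2 + (cmod (b n))\<^sup>2"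
    by auto
qed

lemma hardy_summable_inner:
  assumes "hardy f" "hardy g"
  shows "summable (\<lambda>n. taylor_coeff f n * cnj (taylor_coeff g n))"
  by (rule summable_norm_cancel)
    (simp add: norm_mult summable_inner[OF hardyD2[OF assms(1)] hardyD2[OF assms(2)]])

lemma H2_inner_sums:
  assumes "hardy f" "hardy g"
  shows "(\<lambda>n. taylor_coeff f n * cnj (taylor_coeff g n)) sums H2_inner f g"
  unfolding H2_inner_def using hardy_summable_inner[OF assms] by (rule summable_sums)

lemma hardy_add:
  assumes "hardy f" "hardy g" shows "hardy (\<lambda>z. f z + g z)"
proof -
  have "summable (\<lambda>n. (cmod (taylor_coeff f n + taylor_coeff g n))\<^sup>2)"
  proof (rule summable_comparison_test)
    show "summable (\<lambda>n. 2 * (cmod (taylor_coeff f n))\<^sup>2 + 2 * (cmod (taylor_coeff g n))\<^sup>2)"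
      by (intro summable_add summable_mult hardyD2 assms)
    have "(cmod (a + b))\<^sup>2 \<le> 2 * (cmod a)\<^sup>2 + 2 * (cmod b)\<^sup>2" for a b
    proof -
      have "(cmod (a + b))\<^sup>2 \<le> (cmod a + cmod b)\<^sup>2" by (intro power_mono norm_triangle_ineq) auto
      also have "\<dots> \<le> 2 * (cmod a)\<^sup>2 + 2 * (cmod b)\<^sup>2"
        using sum_squares_bound[of "cmod a" "cmod b"] by (simp add: power2_sum)
      finally show ?thesis .
    qed
    then show "\<exists>N. \<forall>n\<ge>N. norm ((cmod (taylor_coeff f n + taylor_coeff g n))\<^sup>2)
        \<le> 2 * (cmod (taylor_coeff f n))\<^sup>2 + 2 * (cmod (taylor_coeff g n))\<^sup>2" by auto
  qed
  then show ?thesis using assms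
    by (auto simp: hardy_def taylor_coeff_add intro!: holomorphic_intros)
qed

lemma hardy_cmult:
  assumes "hardy f" shows "hardy (\<lambda>z. c * f z)"
  using assms by (auto simp: hardy_def taylor_coeff_cmult norm_mult power_mult_distrib
      intro!: holomorphic_intros summable_mult)

lemma hardy_diff:
  assumes "hardy f" "hardy g" shows "hardy (\<lambda>z. f z - g z)"
  using hardy_add[OF assms(1) hardy_cmult[OF assms(2), of "-1"]] by simp

lemma hardy_mult_id:
  assumes "hardy f" shows "hardy (\<lambda>z. z * f z)"
proof -
  have "summable (\<lambda>n. (cmod (case_nat 0 (taylor_coeff f) n))\<^sup>2)"
    by (subst summable_Suc_iff[symmetric]) (simp add: hardyD2 assms)
  then show ?thesis using assms
    by (auto simp: hardy_def taylor_coeff_mult_id intro!: holomorphic_intros)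
qed

lemma H2_add: "f \<in> H2 \<Longrightarrow> g \<in> H2 \<Longrightarrow> (\<lambda>z. f z + g z) \<in> H2"
  and H2_diff: "f \<in> H2 \<Longrightarrow> g \<in> H2 \<Longrightarrow> (\<lambda>z. f z - g z) \<in> H2"
  and H2_cmult: "f \<in> H2 \<Longrightarrow> (\<lambda>z. c * f z) \<in> H2"
  by (auto simp: H2_iff hardy_add hardy_diff hardy_cmult)

lemma H2_inner_add_left:
  assumes "hardy f" "hardy g" "hardy h"
  shows "H2_inner (\<lambda>z. f z + g z) h = H2_inner f h + H2_inner g h"
  using sums_add[OF H2_inner_sums[OF assms(1,3)] H2_inner_sums[OF assms(2,3)]]
  unfolding H2_inner_def[of "\<lambda>z. f z + g z"]
  by (intro sums_unique[symmetric]) (simp add: taylor_coeff_add hardyD1 assms ring_distribs)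

lemma H2_inner_cmult_left:
  assumes "hardy f" "hardy h"
  shows "H2_inner (\<lambda>z. c * f z) h = c * H2_inner f h"
  using sums_mult[OF H2_inner_sums[OF assms], of c]
  unfolding H2_inner_def[of "\<lambda>z. c * f z"]
  by (intro sums_unique[symmetric]) (simp add: taylor_coeff_cmult hardyD1 assms mult.assoc)

lemma H2_inner_cnj:
  assumes "hardy f" "hardy g"
  shows "cnj (H2_inner f g) = H2_inner g f"
proof -
  have "(\<lambda>n. cnj (taylor_coeff f n * cnj (taylor_coeff g n))) sums cnj (H2_inner f g)"
    using H2_inner_sums[OF assms] by (subst sums_cnj)
  then show ?thesis unfolding H2_inner_def[of g f] by (intro sums_unique) (simp add: mult.commute)
qed

lemma H2_inner_diff_left:
  assumes "hardy f" "hardy g" "hardy h"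
  shows "H2_inner (\<lambda>z. f z - g z) h = H2_inner f h - H2_inner g h"
  using H2_inner_add_left[OF assms(1) hardy_cmult[OF assms(2)] assms(3), of "-1"]
    H2_inner_cmult_left[OF assms(2,3), of "-1"] by simp

lemma H2_inner_add_right:
  assumes "hardy f" "hardy g" "hardy h"
  shows "H2_inner h (\<lambda>z. f z + g z) = H2_inner h f + H2_inner h g"
  using H2_inner_add_left[OF assms, THEN arg_cong[of _ _ cnj]] assms
  by (simp add: H2_inner_cnj hardy_add)

lemma H2_inner_cmult_right:
  assumes "hardy f" "hardy h"
  shows "H2_inner h (\<lambda>z. c * f z) = cnj c * H2_inner h f"
  using H2_inner_cmult_left[OF assms, of c, THEN arg_cong[of _ _ cnj]] assms
  by (simp add: H2_inner_cnj hardy_cmult)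

lemma H2_norm_nonneg: "hardy f \<Longrightarrow> 0 \<le> H2_norm f"
  by (simp add: H2_norm_def suminf_nonneg hardyD2)

lemma H2_norm_power2:
  "hardy f \<Longrightarrow> (H2_norm f)\<^sup>2 = (\<Sum>n. (cmod (taylor_coeff f n))\<^sup>2)"
  by (simp add: H2_norm_def suminf_nonneg hardyD2)

lemma H2_inner_self:
  assumes "hardy f" shows "H2_inner f f = complex_of_real ((H2_norm f)\<^sup>2)"
proof -
  have "(\<lambda>n. complex_of_real ((cmod (taylor_coeff f n))\<^sup>2)) sums complex_of_real ((H2_norm f)\<^sup>2)"
    unfolding H2_norm_power2[OF assms] using hardyD2[OF assms] by (intro sums_of_real summable_sums)
  then show ?thesis unfolding H2_inner_def
    by (intro sums_unique[symmetric]) (simp add: complex_norm_square[symmetric])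
qed

text \<open>The shift only prepends a zero coefficient. This stands in for \<open>cmod z = 1\<close>
  on the boundary circle, so that no boundary values are needed.\<close>

lemma H2_inner_mult_id:
  assumes "hardy f" "hardy g"
  shows "H2_inner (\<lambda>z. z * f z) (\<lambda>z. z * g z) = H2_inner f g"
proof -
  have "(\<lambda>n. case_nat 0 (taylor_coeff f) n * cnj (case_nat 0 (taylor_coeff g) n)) sums H2_inner f g"
    using sums_Suc[of "\<lambda>n. case_nat 0 (taylor_coeff f) n * cnj (case_nat 0 (taylor_coeff g) n)"]
      H2_inner_sums[OF assms] by simp
  then show ?thesis unfolding H2_inner_def[of "\<lambda>z. z * f z"]
    by (intro sums_unique[symmetric]) (simp add: taylor_coeff_mult_id hardyD1 assms)
qed

lemma H2_Cauchy_Schwarz: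
  assumes "hardy f" "hardy g"
  shows "cmod (H2_inner f g) \<le> H2_norm f * H2_norm g"
proof -
  let ?a = "\<lambda>n. cmod (taylor_coeff f n)" and ?b = "\<lambda>n. cmod (taylor_coeff g n)"
  have s: "summable (\<lambda>n. ?a n * ?b n)"
    using assms by (intro summable_inner hardyD2)
  have L2: "L2_set (\<lambda>n. cmod (taylor_coeff h n)) {..<N} \<le> H2_norm h" if "hardy h" for h N
    unfolding L2_set_def H2_norm_def
    by (intro real_sqrt_le_mono sum_le_suminf hardyD2 that) auto
  have "cmod (H2_inner f g) \<le> (\<Sum>n. ?a n * ?b n)"
    unfolding H2_inner_def
    using summable_norm[of "\<lambda>n. taylor_coeff f n * cnj (taylor_coeff g n)"] s by (simp add: norm_mult)
  also have "\<dots> \<le> H2_norm f * H2_norm g"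
  proof (rule suminf_le_const[OF s])
    fix N
    have "(\<Sum>n<N. ?a n * ?b n) \<le> L2_set ?a {..<N} * L2_set ?b {..<N}"
      using L2_set_mult_ineq[of ?a ?b "{..<N}"] by simp
    also have "\<dots> \<le> H2_norm f * H2_norm g"
      by (intro mult_mono L2 assms H2_norm_nonneg) (auto simp: L2_set_nonneg)
    finally show "(\<Sum>n<N. ?a n * ?b n) \<le> H2_norm f * H2_norm g" .
  qed
  finally show ?thesis .
qed

lemma H2_norm_add_power2:
  assumes "hardy f" "hardy g"
  shows "(H2_norm (\<lambda>z. f z + g z))\<^sup>2 = (H2_norm f)\<^sup>2 + (H2_norm g)\<^sup>2 + 2 * Re (H2_inner f g)"
proof -
  have "complex_of_real ((H2_norm (\<lambda>z. f z + g z))\<^sup>2)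
      = H2_inner (\<lambda>z. f z + g z) (\<lambda>z. f z + g z)"
    using assms by (simp only: H2_inner_self hardy_add)
  also have "\<dots> = H2_inner f f + H2_inner g g + (H2_inner f g + cnj (H2_inner f g))"
    using assms by (simp add: H2_inner_add_left H2_inner_add_right hardy_add H2_inner_cnj)
  finally have "complex_of_real ((H2_norm (\<lambda>z. f z + g z))\<^sup>2)
    = complex_of_real ((H2_norm f)\<^sup>2 + (H2_norm g)\<^sup>2 + 2 * Re (H2_inner f g))"
    using assms by (simp add: H2_inner_self complex_add_cnj)
  then show ?thesis by (simp only: of_real_eq_iff)
qed

lemma H2_norm_diff_power2:
  assumes "hardy f" "hardy g"
  shows "(H2_norm (\<lambda>z. f z - g z))\<^sup>2 = (H2_norm f)\<^sup>2 + (H2_norm g)\<^sup>2 - 2 * Re (H2_inner f g)"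
proof -
  have "H2_norm (\<lambda>z. (-1) * g z) = H2_norm g"
    unfolding H2_norm_def using assms by (subst taylor_coeff_cmult) (auto simp: hardyD1)
  then show ?thesis
    using H2_norm_add_power2[OF assms(1) hardy_cmult[OF assms(2), of "-1"]]
      H2_inner_cmult_right[OF assms(2,1), of "-1"] by simp
qed

lemma H2_norm_cmult: "hardy f \<Longrightarrow> H2_norm (\<lambda>z. c * f z) = cmod c * H2_norm f"
  by (simp add: H2_norm_def taylor_coeff_cmult hardyD1 norm_mult power_mult_distrib suminf_mult
      hardyD2 real_sqrt_mult)

text \<open>Passes from a formula to the representative that \<open>H2\<close> asks for. Taylor
  coefficients at 0, and with them norms and inner products, do not change.\<close>

definition disk_restrict :: "(complex \<Rightarrow> complex) \<Rightarrow> complex \<Rightarrow> complex"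
  where "disk_restrict f = (\<lambda>z. if z \<in> unit_disk then f z else 0)"

lemma disk_restrict_apply [simp]: "z \<in> unit_disk \<Longrightarrow> disk_restrict f z = f z"
  by (simp add: disk_restrict_def)

lemma disk_restrict_H2: "disk_restrict f \<in> H2 \<longleftrightarrow> hardy f"
  using hardy_cong[of "disk_restrict f" f] by (auto simp: H2_iff disk_restrict_def)

lemma taylor_coeff_disk_restrict: "taylor_coeff (disk_restrict f) = taylor_coeff f"
  by (rule taylor_coeff_cong) simp

lemma H2_inner_restrict [simp]:
  "H2_inner (disk_restrict f) g = H2_inner f g" "H2_inner g (disk_restrict f) = H2_inner g f"
  by (simp_all add: H2_inner_def taylor_coeff_disk_restrict)

lemma H2_eqI:
  assumes "f \<in> H2" "g \<in> H2" "\<And>z. z \<in> unit_disk \<Longrightarrow> f z = g z"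
  shows "f = g"
proof
  fix z show "f z = g z"
    using assms by (cases "z \<in> unit_disk") (auto simp: H2_iff)
qed

section \<open>Szego kernels and point evaluations\<close>

definition szego :: "complex \<Rightarrow> complex \<Rightarrow> complex"
  where "szego w z = 1 / (1 - cnj w * z)"

lemma szego_sums:
  assumes "w \<in> unit_disk" "z \<in> unit_disk"
  shows "(\<lambda>n. cnj w ^ n * z ^ n) sums szego w z"
proof -
  have "cmod (cnj w * z) < 1"
    using mult_strict_mono'[of "cmod w" 1 "cmod z" 1] assms by (simp add: norm_mult)
  from geometric_sums[OF this] show ?thesis by (simp add: szego_def power_mult_distrib)
qed

lemma taylor_coeff_szego:
  assumes "w \<in> unit_disk" shows "taylor_coeff (szego w) = (\<lambda>n. cnj w ^ n)"
  using szego_sums[OF assms] by (rule sums_imp_taylor_coeff)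

lemma hardy_szego: assumes "w \<in> unit_disk" shows "hardy (szego w)"
proof -
  have "szego w holomorphic_on unit_disk"
    using szego_sums[OF assms] by (rule sums_imp_holomorphic)
  moreover have "summable (\<lambda>n. ((cmod w)\<^sup>2) ^ n)"
    using assms by (intro summable_geometric) (simp add: abs_square_less_1)
  ultimately show ?thesis
    by (simp add: hardy_def taylor_coeff_szego[OF assms] norm_power power_mult[symmetric] mult.commute)
qed

text \<open>The kernel has coefficients \<open>cnj w ^ n\<close>, so the inner product with it is
  literally the Taylor series of \<open>f\<close> at \<open>w\<close>.\<close>

lemma szego_reproducing:
  assumes "hardy f" "w \<in> unit_disk" shows "H2_inner f (szego w) = f w"
proof -
  have "(\<lambda>n. taylor_coeff f n * w ^ n) sums f w"
    using assms by (intro taylor_coeff_sums hardyD1)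
  then show ?thesis
    unfolding H2_inner_def taylor_coeff_szego[OF assms(2)] by (simp add: sums_iff)
qed

text \<open>Testing against the kernels recovers all values on the disk. This is how the adjoint is
  identified later.\<close>

lemma H2_inner_eqI:
  assumes "g \<in> H2" "h \<in> H2" "\<And>f. f \<in> H2 \<Longrightarrow> H2_inner f g = H2_inner f h"
  shows "g = h"
proof (rule H2_eqI[OF assms(1,2)])
  fix z :: complex assume z: "z \<in> unit_disk"
  have *: "f z = cnj (H2_inner (disk_restrict (szego z)) f)" if "f \<in> H2" for f
    using szego_reproducing[OF H2_hardy[OF that] z] H2_inner_cnj[OF hardy_szego[OF z] H2_hardy[OF that]]
    by simp
  have "disk_restrict (szego z) \<in> H2" using z by (simp add: disk_restrict_H2 hardy_szego)
  from assms(3)[OF this] show "g z = h z" by (simp add: * assms(1,2))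
qed

section \<open>Isometries, conjugations and adjoints\<close>

text \<open>Polarization: the norm of a sum determines the real part of the inner product. The form
  for additive maps covers linear isometries and antilinear conjugations alike.\<close>

lemma isometry_inner_Re:
  assumes T: "T \<in> H2 \<rightarrow> H2"
    and add: "\<And>f g. f \<in> H2 \<Longrightarrow> g \<in> H2 \<Longrightarrow> T (\<lambda>z. f z + g z) = (\<lambda>z. T f z + T g z)"
    and norm: "\<And>f. f \<in> H2 \<Longrightarrow> H2_norm (T f) = H2_norm f"
    and f: "f \<in> H2" and g: "g \<in> H2"
  shows "Re (H2_inner (T f) (T g)) = Re (H2_inner f g)"
proof -
  have Tf: "T f \<in> H2" and Tg: "T g \<in> H2" using T f g by auto
  have "(H2_norm (\<lambda>z. T f z + T g z))\<^sup>2 = (H2_norm (\<lambda>z. f z + g z))\<^sup>2"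
    using norm[OF H2_add[OF f g]] add[OF f g] by simp
  then show ?thesis
    using H2_norm_add_power2[OF H2_hardy[OF Tf] H2_hardy[OF Tg]]
      H2_norm_add_power2[OF H2_hardy[OF f] H2_hardy[OF g]] norm[OF f] norm[OF g] by simp
qed

lemma Im_H2_inner:
  assumes "hardy f" "hardy g"
  shows "Im (H2_inner f g) = Re (H2_inner f (\<lambda>z. \<i> * g z))"
  using H2_inner_cmult_right[OF assms(2,1), of \<i>] by simp

lemma H2_isometry_inner:
  assumes "H2_isometry T" and f: "f \<in> H2" and g: "g \<in> H2"
  shows "H2_inner (T f) (T g) = H2_inner f g"
proof -
  from assms(1) have T: "T \<in> H2 \<rightarrow> H2"
    and add: "\<And>f g. f \<in> H2 \<Longrightarrow> g \<in> H2 \<Longrightarrow> T (\<lambda>z. f z + g z) = (\<lambda>z. T f z + T g z)"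
    and scale: "\<And>a f. f \<in> H2 \<Longrightarrow> T (\<lambda>z. a * f z) = (\<lambda>z. a * T f z)"
    and norm: "\<And>f. f \<in> H2 \<Longrightarrow> H2_norm (T f) = H2_norm f"
    by (auto simp: H2_isometry_def H2_bounded_operator_def)
  have h: "hardy f" "hardy g" "hardy (T f)" "hardy (T g)" using T f g by (auto intro: H2_hardy)
  show ?thesis
  proof (rule complex_eqI)
    show "Re (H2_inner (T f) (T g)) = Re (H2_inner f g)"
      by (rule isometry_inner_Re) (use T add norm f g in auto)
    have "Re (H2_inner (T f) (T (\<lambda>z. \<i> * g z))) = Re (H2_inner f (\<lambda>z. \<i> * g z))"
      by (rule isometry_inner_Re) (use T add norm f g H2_cmult in auto)
    then show "Im (H2_inner (T f) (T g)) = Im (H2_inner f g)"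
      using h by (simp add: Im_H2_inner scale[OF g])
  qed
qed

lemma H2_conjugation_inner:
  assumes "H2_conjugation C" and f: "f \<in> H2" and g: "g \<in> H2"
  shows "H2_inner (C f) (C g) = H2_inner g f"
proof -
  from assms(1) have T: "C \<in> H2 \<rightarrow> H2"
    and add: "\<And>f g. f \<in> H2 \<Longrightarrow> g \<in> H2 \<Longrightarrow> C (\<lambda>z. f z + g z) = (\<lambda>z. C f z + C g z)"
    and scale: "\<And>a f. f \<in> H2 \<Longrightarrow> C (\<lambda>z. a * f z) = (\<lambda>z. cnj a * C f z)"
    and norm: "\<And>f. f \<in> H2 \<Longrightarrow> H2_norm (C f) = H2_norm f"
    by (auto simp: H2_conjugation_def)
  have h: "hardy f" "hardy g" "hardy (C f)" "hardy (C g)" using T f g by (auto intro: H2_hardy)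
  have "H2_inner (C f) (C g) = cnj (H2_inner f g)"
  proof (rule complex_eqI)
    have "Re (H2_inner (C f) (C g)) = Re (H2_inner f g)"
      by (rule isometry_inner_Re) (use T add norm f g in auto)
    then show "Re (H2_inner (C f) (C g)) = Re (cnj (H2_inner f g))" by simp
    have "Re (H2_inner (C f) (C (\<lambda>z. \<i> * g z))) = Re (H2_inner f (\<lambda>z. \<i> * g z))"
      by (rule isometry_inner_Re) (use T add norm f g H2_cmult in auto)
    \<comment> \<open>Antilinearity gives \<open>C\<close> of \<open>\<i> * g\<close> as
      \<open>cnj \<i> * C g\<close>, and the second slot conjugates again. The two sides therefore
      carry opposite factors, and the imaginary part changes sign.\<close>
    then have "Re (cnj (cnj \<i>) * H2_inner (C f) (C g)) = Re (cnj \<i> * H2_inner f g)"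
      unfolding scale[OF g] H2_inner_cmult_right[OF h(2,1)] H2_inner_cmult_right[OF h(4,3)] .
    then show "Im (H2_inner (C f) (C g)) = Im (cnj (H2_inner f g))" by simp
  qed
  with h show ?thesis by (simp add: H2_inner_cnj)
qed

section \<open>Polynomial approximation and existence of adjoints\<close>

text \<open>The coefficient sequence is arbitrary: it will be that of a given function, but also the
  sequence \<open>b\<close> used as a test vector in Bessel's inequality.\<close>

definition taylor_poly :: "(nat \<Rightarrow> complex) \<Rightarrow> nat \<Rightarrow> complex \<Rightarrow> complex"
  where "taylor_poly a N = disk_restrict (\<lambda>z. \<Sum>n<N. a n * z ^ n)"

lemma taylor_coeff_taylor_poly:
  "taylor_coeff (taylor_poly a N) = (\<lambda>n. if n < N then a n else 0)"
  unfolding taylor_poly_def taylor_coeff_disk_restrict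
proof (rule sums_imp_taylor_coeff)
  fix z :: complex
  have "(\<lambda>n. if n \<in> {..<N} then a n * z ^ n else 0) sums (\<Sum>n<N. a n * z ^ n)"
    by (rule sums_If_finite_set) simp
  then show "(\<lambda>n. (if n < N then a n else 0) * z ^ n) sums (\<Sum>n<N. a n * z ^ n)"
    by (rule sums_cong[THEN iffD1, rotated]) auto
qed

lemma taylor_poly_H2: "taylor_poly a N \<in> H2"
proof -
  have "summable (\<lambda>n. (cmod (taylor_coeff (taylor_poly a N) n))\<^sup>2)"
    by (rule summable_finite[of "{..<N}"]) (auto simp: taylor_coeff_taylor_poly)
  then have "hardy (\<lambda>z. \<Sum>n<N. a n * z ^ n)"
    unfolding taylor_poly_def taylor_coeff_disk_restrict
    by (auto simp: hardy_def intro!: holomorphic_intros)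
  then show ?thesis by (simp add: taylor_poly_def disk_restrict_H2)
qed

lemma H2_norm_taylor_poly: "(H2_norm (taylor_poly a N))\<^sup>2 = (\<Sum>n<N. (cmod (a n))\<^sup>2)"
proof -
  have "(\<Sum>n. (cmod (taylor_coeff (taylor_poly a N) n))\<^sup>2)
      = (\<Sum>n<N. (cmod (taylor_coeff (taylor_poly a N) n))\<^sup>2)"
    by (rule suminf_finite) (auto simp: taylor_coeff_taylor_poly)
  then show ?thesis
    by (simp add: H2_norm_power2 H2_hardy taylor_poly_H2 taylor_coeff_taylor_poly)
qed

lemma taylor_poly_Suc:
  "taylor_poly a (Suc N) = (\<lambda>z. taylor_poly a N z + a N * disk_restrict (\<lambda>z. z ^ N) z)"
  by (auto simp: taylor_poly_def disk_restrict_def)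

lemma H2_monomial: "disk_restrict (\<lambda>z. z ^ N) \<in> H2"
proof -
  have "(\<Sum>n<N. (if n = N then 1 else 0) * z ^ n) = 0" for z :: complex
    by (rule sum.neutral) auto
  then have "disk_restrict (\<lambda>z. z ^ N) = taylor_poly (\<lambda>n. if n = N then 1 else 0) (Suc N)"
    by (simp add: taylor_poly_def)
  then show ?thesis by (simp only: taylor_poly_H2)
qed

text \<open>The squared norm of the remainder is the tail of a convergent series. Hence polynomials
  are dense, which carries adjoint identities from polynomials to all of \<open>H2\<close>.\<close>

lemma H2_norm_taylor_tail:
  assumes "f \<in> H2"
  shows "(\<lambda>N. H2_norm (\<lambda>z. f z - taylor_poly (taylor_coeff f) N z)) \<longlonglongrightarrow> 0"
proof -
  let ?r = "\<lambda>N z. f z - taylor_poly (taylor_coeff f) N z"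
  let ?s = "\<lambda>n. (cmod (taylor_coeff f n))\<^sup>2"
  have s: "summable ?s" using assms by (intro hardyD2 H2_hardy)
  have c: "taylor_coeff (?r N) = (\<lambda>n. if n < N then 0 else taylor_coeff f n)" for N
    by (subst taylor_coeff_diff)
      (auto simp: hardyD1 H2_hardy assms taylor_poly_H2 taylor_coeff_taylor_poly)
  have "H2_norm (?r N) = sqrt (suminf ?s - (\<Sum>n<N. ?s n))" for N
  proof -
    have r: "hardy (?r N)" using assms by (intro hardy_diff H2_hardy taylor_poly_H2)
    have "(\<Sum>n. (cmod (taylor_coeff (?r N) n))\<^sup>2)
        = (\<Sum>n. (cmod (taylor_coeff (?r N) (n + N)))\<^sup>2) + (\<Sum>n<N. (cmod (taylor_coeff (?r N) n))\<^sup>2)"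
      by (rule suminf_split_initial_segment[OF hardyD2[OF r]])
    also have "\<dots> = (\<Sum>n. ?s (n + N))" by (simp add: c)
    also have "\<dots> = suminf ?s - (\<Sum>n<N. ?s n)" using suminf_minus_initial_segment[OF s] by simp
    finally show ?thesis by (simp add: H2_norm_def)
  qed
  moreover have "(\<lambda>N. sqrt (suminf ?s - (\<Sum>n<N. ?s n))) \<longlonglongrightarrow> sqrt (suminf ?s - suminf ?s)"
    by (intro tendsto_intros summable_LIMSEQ s)
  ultimately show ?thesis by simp
qed

text \<open>Bessel's inequality makes the coefficients \<open>\<langle>g, T z\<^sup>n\<rangle>\<close> square summable.\<close>

lemma H2_adjoint_exists:
  assumes "H2_bounded_operator T" and g: "g \<in> H2"
  shows "\<exists>h\<in>H2. \<forall>f\<in>H2. H2_inner (T f) g = H2_inner f h"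
proof -
  from assms(1) obtain M where T: "T \<in> H2 \<rightarrow> H2"
    and add: "\<And>f g. f \<in> H2 \<Longrightarrow> g \<in> H2 \<Longrightarrow> T (\<lambda>z. f z + g z) = (\<lambda>z. T f z + T g z)"
    and scale: "\<And>a f. f \<in> H2 \<Longrightarrow> T (\<lambda>z. a * f z) = (\<lambda>z. a * T f z)"
    and M: "\<And>f. f \<in> H2 \<Longrightarrow> H2_norm (T f) \<le> M * H2_norm f"
    unfolding H2_bounded_operator_def by blast
  have TH: "hardy (T f)" if "f \<in> H2" for f using T that by (auto intro: H2_hardy)
  have bound: "cmod (H2_inner (T f) g) \<le> (M * H2_norm f) * H2_norm g" if "f \<in> H2" for f
    using H2_Cauchy_Schwarz[OF TH[OF that] H2_hardy[OF g]]
      mult_right_mono[OF M[OF that] H2_norm_nonneg[OF H2_hardy[OF g]]] by linarith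
  have diff: "T (\<lambda>z. f z - h z) = (\<lambda>z. T f z - T h z)" if "f \<in> H2" "h \<in> H2" for f h
    using add[OF that(1) H2_cmult[OF that(2), of "-1"]] scale[OF that(2), of "-1"] by simp
  \<comment> \<open>The coefficients that the adjoint image \<open>h\<close> of \<open>g\<close> is
    forced to have: the inner product of \<open>z ^ n\<close> with \<open>h\<close> is the conjugate
    of the n-th coefficient of \<open>h\<close>.\<close>
  define b where "b n = cnj (H2_inner (T (disk_restrict (\<lambda>z. z ^ n))) g)" for n
  have poly: "H2_inner (T (taylor_poly a N)) g = (\<Sum>n<N. a n * cnj (b n))" for a N
  proof (induction N)
    case 0
    \<comment> \<open>The empty polynomial is 0 times itself, so homogeneity sends it to 0.\<close>
    have "T (taylor_poly a 0) = (\<lambda>z. 0 * T (taylor_poly a 0) z)"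
      using scale[OF taylor_poly_H2[of a 0], of 0] by (simp add: taylor_poly_def disk_restrict_def)
    then have "H2_inner (T (taylor_poly a 0)) g = 0 * H2_inner (T (taylor_poly a 0)) g"
      using H2_inner_cmult_left[OF TH[OF taylor_poly_H2[of a 0]] H2_hardy[OF g], of 0] by simp
    then show ?case by simp
  next
    case (Suc N)
    let ?m = "disk_restrict (\<lambda>z. z ^ N)"
    have "T (taylor_poly a (Suc N)) = (\<lambda>z. T (taylor_poly a N) z + a N * T ?m z)"
      unfolding taylor_poly_Suc
      by (simp add: add[OF taylor_poly_H2 H2_cmult[OF H2_monomial]] scale[OF H2_monomial])
    then have "H2_inner (T (taylor_poly a (Suc N))) g
        = H2_inner (T (taylor_poly a N)) g + a N * H2_inner (T ?m) g"
      using H2_inner_add_left[OF TH[OF taylor_poly_H2] hardy_cmult[OF TH[OF H2_monomial]] H2_hardy[OF g]]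
        H2_inner_cmult_left[OF TH[OF H2_monomial] H2_hardy[OF g]] by simp
    then show ?case by (simp add: Suc.IH b_def)
  qed
  \<comment> \<open>The test vector is the polynomial with coefficients \<open>b\<close> itself. Its
    norm is \<open>sqrt S\<close> and its image has inner product \<open>S\<close> with
    \<open>g\<close>, so boundedness gives \<open>S \<le> M * sqrt S * H2_norm g\<close>, and
    \<open>sqrt S\<close> cancels unless \<open>S = 0\<close>.\<close>
  have Bessel: "(\<Sum>n<N. (cmod (b n))\<^sup>2) \<le> (M * H2_norm g)\<^sup>2" for N
  proof -
    define S where "S = (\<Sum>n<N. (cmod (b n))\<^sup>2)"
    have S0: "0 \<le> S" by (simp add: S_def sum_nonneg)
    have nS: "H2_norm (taylor_poly b N) = sqrt S"
      using H2_norm_taylor_poly[of b N] H2_norm_nonneg[OF H2_hardy[OF taylor_poly_H2[of b N]]]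
      by (simp add: S_def real_sqrt_unique)
    have "H2_inner (T (taylor_poly b N)) g = complex_of_real S"
      by (simp add: poly S_def complex_norm_square[symmetric])
    then have "S \<le> (M * sqrt S) * H2_norm g"
      using bound[OF taylor_poly_H2[of b N]] S0 by (simp add: nS)
    then have "sqrt S * sqrt S \<le> sqrt S * (M * H2_norm g)"
      using S0 by (simp add: mult_ac)
    then have "S = 0 \<or> sqrt S \<le> M * H2_norm g"
      using S0 mult_le_cancel_left_pos[of "sqrt S" "sqrt S" "M * H2_norm g"] by (cases "S = 0") auto
    then have "S \<le> (M * H2_norm g)\<^sup>2"
    proof
      assume "sqrt S \<le> M * H2_norm g"
      from power_mono[OF this, of 2] S0 show ?thesis by simp
    qed simp
    then show ?thesis by (simp only: S_def)
  qed
  have sb: "summable (\<lambda>n. (cmod (b n))\<^sup>2)"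
    by (rule summableI_nonneg_bounded[OF _ Bessel]) simp
  define h where "h = (\<lambda>z. \<Sum>n. b n * z ^ n)"
  \<comment> \<open>The powers of \<open>z\<close> are the coefficients of the kernel at
    \<open>cnj z\<close>, hence square summable, and so is \<open>b\<close>. Their product is
    therefore absolutely summable.\<close>
  have h_sums: "(\<lambda>n. b n * z ^ n) sums h z" if "z \<in> unit_disk" for z
  proof -
    have "hardy (szego (cnj z))" using that by (intro hardy_szego) simp
    from hardyD2[OF this] have "summable (\<lambda>n. (cmod (z ^ n))\<^sup>2)"
      using that by (simp add: taylor_coeff_szego)
    from summable_inner[OF sb this] have "summable (\<lambda>n. norm (b n * z ^ n))"
      by (simp add: norm_mult)
    then have "summable (\<lambda>n. b n * z ^ n)" by (rule summable_norm_cancel)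
    then show ?thesis by (simp add: h_def summable_sums)
  qed
  have cb: "taylor_coeff h = b" using h_sums by (rule sums_imp_taylor_coeff)
  have hh: "hardy h" using sums_imp_holomorphic[OF h_sums] sb by (simp add: hardy_def cb)
  show ?thesis
  proof (intro bexI[of _ "disk_restrict h"] ballI)
    show "disk_restrict h \<in> H2" using hh by (simp add: disk_restrict_H2)
    fix f assume f: "f \<in> H2"
    let ?p = "taylor_poly (taylor_coeff f)"
    have lim1: "(\<lambda>N. H2_inner (T (?p N)) g) \<longlonglongrightarrow> H2_inner f h"
      using H2_inner_sums[OF H2_hardy[OF f] hh] by (simp add: poly sums_def cb)
    \<comment> \<open>Boundedness of \<open>T\<close> controls the error by the norm of the Taylor
      remainder of \<open>f\<close>.\<close>
    have "(\<lambda>N. H2_inner (T f) g - H2_inner (T (?p N)) g) \<longlonglongrightarrow> 0"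
    proof (rule Lim_null_comparison)
      have "norm (H2_inner (T f) g - H2_inner (T (?p N)) g)
          \<le> (M * H2_norm (\<lambda>z. f z - ?p N z)) * H2_norm g" for N
        using bound[OF H2_diff[OF f taylor_poly_H2]]
        by (simp add: diff f taylor_poly_H2 H2_inner_diff_left TH H2_hardy g)
      then show "\<forall>\<^sub>F N in sequentially. norm (H2_inner (T f) g - H2_inner (T (?p N)) g)
          \<le> (M * H2_norm (\<lambda>z. f z - ?p N z)) * H2_norm g" by simp
      have "(\<lambda>N. (M * H2_norm (\<lambda>z. f z - ?p N z)) * H2_norm g) \<longlonglongrightarrow> (M * 0) * H2_norm g"
        by (intro tendsto_intros H2_norm_taylor_tail f)
      then show "(\<lambda>N. (M * H2_norm (\<lambda>z. f z - ?p N z)) * H2_norm g) \<longlonglongrightarrow> 0" by simp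
    qed
    from tendsto_diff[OF tendsto_const[of "H2_inner (T f) g"] this]
    have "(\<lambda>N. H2_inner (T (?p N)) g) \<longlonglongrightarrow> H2_inner (T f) g" by simp
    from LIMSEQ_unique[OF this lim1] show "H2_inner (T f) g = H2_inner f (disk_restrict h)" by simp
  qed
qed

text \<open>Choosing an image for each \<open>g\<close> assembles one operator, which is the witness
  needed to unfold the choice in \<open>H2_adjoint\<close>.\<close>

lemma H2_adjoint:
  assumes "H2_bounded_operator T"
  shows "H2_adjoint T \<in> H2 \<rightarrow> H2"
    and "\<And>f g. f \<in> H2 \<Longrightarrow> g \<in> H2 \<Longrightarrow> H2_inner (T f) g = H2_inner f (H2_adjoint T g)"
proof -
  from H2_adjoint_exists[OF assms] obtain S
    where "\<And>g. g \<in> H2 \<Longrightarrow> S g \<in> H2 \<and> (\<forall>f\<in>H2. H2_inner (T f) g = H2_inner f (S g))"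
    by metis
  then have "\<exists>S. S \<in> H2 \<rightarrow> H2 \<and> (\<forall>f\<in>H2. \<forall>g\<in>H2. H2_inner (T f) g = H2_inner f (S g))"
    by auto
  from someI_ex[OF this] show "H2_adjoint T \<in> H2 \<rightarrow> H2"
    and "\<And>f g. f \<in> H2 \<Longrightarrow> g \<in> H2 \<Longrightarrow> H2_inner (T f) g = H2_inner f (H2_adjoint T g)"
    unfolding H2_adjoint_def[symmetric] by auto
qed

section \<open>Isometric complex symmetric weighted composition operators\<close>

lemma isometric_complex_symmetric_kernel:
  assumes phi: "\<phi> ` unit_disk \<subseteq> unit_disk"
    and iso: "H2_isometry (weighted_comp \<psi> \<phi>)" and sym: "complex_symmetric (weighted_comp \<psi> \<phi>)"
    and z: "z \<in> unit_disk" and w: "w \<in> unit_disk"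
  shows "\<psi> z * cnj (\<psi> w) * szego (\<phi> w) (\<phi> z) = szego w z"
proof -
  define T where "T = weighted_comp \<psi> \<phi>"
  define A where "A = H2_adjoint T"
  define k where "k x = disk_restrict (szego x)" for x
  from sym obtain C where bT: "H2_bounded_operator T" and C: "H2_conjugation C"
    and CAC: "\<And>f. f \<in> H2 \<Longrightarrow> C (A (C f)) = T f"
    by (auto simp: complex_symmetric_def complex_symmetric_with_def T_def A_def)
  have TH: "T f \<in> H2" if "f \<in> H2" for f
    using bT that by (auto simp: H2_bounded_operator_def)
  have CH: "C f \<in> H2" and CC: "C (C f) = f" if "f \<in> H2" for f
    using C that by (auto simp: H2_conjugation_def)
  have AH: "A g \<in> H2" if "g \<in> H2" for g
    using H2_adjoint(1)[OF bT] that by (auto simp: A_def)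
  have adj: "H2_inner (T f) g = H2_inner f (A g)" if "f \<in> H2" "g \<in> H2" for f g
    using H2_adjoint(2)[OF bT that] by (simp add: A_def)
  have A: "A g = C (T (C g))" if "g \<in> H2" for g
    using CAC[OF CH[OF that]] CC[OF that] CC[OF AH[OF that]] by metis
  have A_inner: "H2_inner (A f) (A g) = H2_inner f g" if "f \<in> H2" "g \<in> H2" for f g
  proof -
    \<comment> \<open>Each of the two conjugations in \<open>A = C T C\<close> swaps the arguments,
      so the original order returns.\<close>
    have "H2_inner (A f) (A g) = H2_inner (T (C g)) (T (C f))"
      using that by (simp add: A H2_conjugation_inner[OF C] TH CH)
    also have "\<dots> = H2_inner (C g) (C f)"
      using that iso by (intro H2_isometry_inner CH) (auto simp: T_def)
    finally show ?thesis using that by (simp add: H2_conjugation_inner[OF C])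
  qed
  have kH: "k x \<in> H2" if "x \<in> unit_disk" for x
    using that by (simp add: k_def disk_restrict_H2 hardy_szego)
  have rep: "H2_inner f (k x) = f x" if "f \<in> H2" "x \<in> unit_disk" for f x
    using that by (simp add: k_def szego_reproducing H2_hardy)
  have phi': "\<phi> x \<in> unit_disk" if "x \<in> unit_disk" for x using phi that by blast
  \<comment> \<open>The usual action of the adjoint on kernels: \<open>k w\<close> goes to
    \<open>cnj (\<psi> w)\<close> times the kernel at \<open>\<phi> w\<close>. The conjugate appears
    outside because the kernel is written with its arguments exchanged.\<close>
  have Ak: "A (k w) x = cnj (\<psi> w * szego x (\<phi> w))" if x: "x \<in> unit_disk" for x
  proof -
    have "A (k w) x = cnj (H2_inner (k x) (A (k w)))"
      using x w by (simp add: H2_inner_cnj AH kH H2_hardy rep)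
    also have "\<dots> = cnj (T (k x) w)"
      using x w by (simp add: adj[symmetric] kH rep TH)
    finally show ?thesis using w phi' by (simp add: T_def weighted_comp_def k_def)
  qed
  have "szego w z = H2_inner (k w) (k z)"
    using w z by (simp add: rep kH) (simp add: k_def)
  also have "\<dots> = H2_inner (A (k w)) (A (k z))"
    using w z by (simp add: A_inner kH)
  also have "\<dots> = T (A (k w)) z"
    using w z by (simp add: adj[symmetric] AH kH rep TH)
  also have "\<dots> = \<psi> z * A (k w) (\<phi> z)"
    using z by (simp add: T_def weighted_comp_def)
  also have "\<dots> = \<psi> z * cnj (\<psi> w) * szego (\<phi> w) (\<phi> z)"
    using phi'[OF z] by (simp add: Ak szego_def mult.commute)
  finally show ?thesis by simp
qed

lemma szego_denom_nonzero:
  assumes "w \<in> unit_disk" "z \<in> unit_disk" shows "1 - cnj w * z \<noteq> 0"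
proof
  assume "1 - cnj w * z = 0"
  then have "cmod (cnj w * z) = 1" by (metis eq_iff_diff_eq_0 norm_one)
  moreover have "cmod (cnj w * z) < 1"
    using mult_strict_mono'[of "cmod w" 1 "cmod z" 1] assms by (simp add: norm_mult)
  ultimately show False by simp
qed

lemma weighted_kernel_identity_imp_moebius:
  assumes phi: "\<phi> ` unit_disk \<subseteq> unit_disk"
    and K: "\<And>z w. z \<in> unit_disk \<Longrightarrow> w \<in> unit_disk \<Longrightarrow>
      \<psi> z * cnj (\<psi> w) * szego (\<phi> w) (\<phi> z) = szego w z"
  shows "\<exists>p lam c. p \<in> unit_disk \<and> cmod lam = 1 \<and> cmod c = 1 \<and>
             (\<forall>z\<in>unit_disk. \<phi> z = lam * ((p - z) / (1 - cnj p * z))) \<and>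
             (\<forall>z\<in>unit_disk. \<psi> z = psi_p c p z)"
proof -
  define a where "a = \<phi> 0"
  define b where "b = \<psi> 0"
  have phi': "\<phi> x \<in> unit_disk" if "x \<in> unit_disk" for x using phi that by blast
  have a: "a \<in> unit_disk" unfolding a_def by (rule phi') simp
  have K': "\<psi> z * cnj (\<psi> w) * (1 - cnj w * z) = 1 - cnj (\<phi> w) * \<phi> z"
    if "z \<in> unit_disk" "w \<in> unit_disk" for z w
    using K[OF that] szego_denom_nonzero[OF that(2,1)] szego_denom_nonzero[OF phi'[OF that(2)] phi'[OF that(1)]]
    by (simp add: szego_def divide_simps)
  have psi: "\<psi> z * cnj b = 1 - cnj a * \<phi> z" if "z \<in> unit_disk" for z
    using K'[OF that, of 0] by (simp add: a_def b_def)
  have bb: "b * cnj b = 1 - cnj a * a" using psi[of 0] by (simp add: a_def b_def)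
  have d: "1 - cnj a * \<phi> z \<noteq> 0" if "z \<in> unit_disk" for z
    using szego_denom_nonzero[OF a phi'[OF that]] .
  have d': "1 - a * cnj (\<phi> z) \<noteq> 0" if "z \<in> unit_disk" for z
    using d[OF that] by (metis complex_cnj_cnj complex_cnj_diff complex_cnj_mult complex_cnj_one complex_cnj_zero)
  have s1: "1 - cnj a * a \<noteq> 0" using szego_denom_nonzero[OF a a] .
  then have b0: "b \<noteq> 0" using bb by auto
  define \<sigma> where "\<sigma> z = (\<phi> z - a) / (1 - cnj a * \<phi> z)" for z
  have sigma: "cnj (\<sigma> w) * \<sigma> z = cnj w * z" if z: "z \<in> unit_disk" and w: "w \<in> unit_disk" for z w
  proof -
    let ?X = "\<phi> z" and ?Y = "cnj (\<phi> w)"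
    have psi': "cnj (\<psi> w) * b = 1 - a * ?Y"
      using psi[OF w, THEN arg_cong[of _ _ cnj]] by simp
    \<comment> \<open>Multiplying the kernel identity by \<open>b * cnj b = 1 - cnj a * a\<close>
      eliminates every \<open>\<psi>\<close>. The later call of \<open>algebra\<close> rests on
      \<open>(1 - cnj a * X) * (1 - a * Y) - (1 - cnj a * a) * (1 - Y * X) = (Y - cnj a) * (X -
      a)\<close>.\<close>
    have "(1 - cnj a * ?X) * (1 - a * ?Y) * (1 - cnj w * z) = (\<psi> z * cnj (\<psi> w) * (1 - cnj w * z)) * (b * cnj b)"
      unfolding psi[OF z, symmetric] psi'[symmetric] by (simp only: mult_ac)
    also have "\<dots> = (1 - ?Y * ?X) * (1 - cnj a * a)" using K'[OF z w] bb by simp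
    finally have "(?Y - cnj a) * (?X - a) = cnj w * z * ((1 - cnj a * ?X) * (1 - a * ?Y))"
      by algebra
    moreover have "cnj (\<sigma> w) * \<sigma> z = (?Y - cnj a) * (?X - a) / ((1 - cnj a * ?X) * (1 - a * ?Y))"
      by (simp add: \<sigma>_def mult.commute)
    ultimately show ?thesis using d[OF z] d'[OF w] by simp
  qed
  \<comment> \<open>Fixing one nonzero point \<open>w = 1/2\<close> turns the identity for
    \<open>\<sigma>\<close> into \<open>cnj h * \<sigma> z = z / 2\<close>, so
    \<open>\<sigma>\<close> is linear. Taking \<open>z = 1/2\<close> as well gives
    \<open>cmod h = 1/2\<close>, hence a unimodular slope \<open>\<mu>\<close>.\<close>
  define h where "h = \<sigma> (1/2)"
  have half: "(1/2 :: complex) \<in> unit_disk" by simp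
  have "cnj h * h = 1/4" using sigma[OF half half] by (simp add: h_def)
  then have "complex_of_real ((cmod h)\<^sup>2) = 1/4" by (simp only: complex_norm_square mult.commute)
  then have "(cmod h)\<^sup>2 = (1/2)\<^sup>2"
    by (metis (mono_tags) of_real_1 of_real_divide of_real_eq_iff of_real_numeral power_one_over
        power2_eq_square numeral_times_numeral num_double)
  then have nh: "cmod h = 1/2" by (simp add: power2_eq_iff_nonneg)
  then have h0: "h \<noteq> 0" by auto
  define \<mu> where "\<mu> = 1 / (2 * cnj h)"
  have mu: "cmod \<mu> = 1" by (simp add: \<mu>_def norm_divide norm_mult nh)
  then have mm: "\<mu> * cnj \<mu> = 1" by (simp add: complex_norm_square[symmetric])
  have sz: "\<sigma> z = \<mu> * z" if "z \<in> unit_disk" for z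
    using sigma[OF that half] h0 by (simp add: h_def[symmetric] \<mu>_def field_simps)
  \<comment> \<open>Solving \<open>\<sigma> z = \<mu> * z\<close> for \<open>\<phi>\<close> produces
    the denominator \<open>1 + cnj a * \<mu> * z\<close>, from which \<open>p\<close> is read off.
    It is the zero of \<open>\<phi>\<close>, and the required unimodular factor is
    \<open>- \<mu>\<close>.\<close>
  define p where "p = - a * cnj \<mu>"
  have np: "cmod p = cmod a" by (simp add: p_def norm_mult mu)
  then have p: "p \<in> unit_disk" using a by simp
  have phi_eq: "\<phi> z = (\<mu> * z + a) / (1 - cnj p * z)" if z: "z \<in> unit_disk" for z
  proof -
    have "\<phi> z - a = \<mu> * z * (1 - cnj a * \<phi> z)"
      using sz[OF z] d[OF z] by (simp add: \<sigma>_def field_simps)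
    then have "\<phi> z * (1 - cnj p * z) = \<mu> * z + a"
      by (simp add: p_def algebra_simps)
    then show ?thesis using szego_denom_nonzero[OF p z] by (simp add: field_simps)
  qed
  define s where "s = sqrt (1 - (cmod p)\<^sup>2)"
  have s: "s > 0" "s\<^sup>2 = 1 - (cmod p)\<^sup>2" using p by (auto simp: s_def abs_square_less_1 abs_square_le_1)
  have "complex_of_real ((cmod b)\<^sup>2) = complex_of_real (s\<^sup>2)"
    using bb unfolding s(2) np by (simp only: complex_norm_square of_real_diff of_real_1 mult.commute)
  then have "cmod b = s" using s(1) by (simp only: of_real_eq_iff power2_eq_iff_nonneg norm_ge_zero less_imp_le)
  then have nc: "cmod (b / s) = 1" using s(1) by (simp add: norm_divide)
  have ss: "complex_of_real s * complex_of_real s = b * cnj b"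
    using \<open>cmod b = s\<close> by (simp add: complex_norm_square[symmetric] power2_eq_square)
  show ?thesis
  proof (intro exI conjI ballI)
    show "p \<in> unit_disk" by fact
    show "cmod (- \<mu>) = 1" by (simp add: mu)
    show "cmod (b / s) = 1" by fact
    fix z :: complex assume z: "z \<in> unit_disk"
    have "- \<mu> * (p - z) = \<mu> * z + a" using mm by (simp add: p_def algebra_simps)
    then show "\<phi> z = - \<mu> * ((p - z) / (1 - cnj p * z))" by (simp add: phi_eq[OF z])
    \<comment> \<open>With the denominator cleared, the terms in \<open>z\<close> cancel and only
      the constant \<open>b * cnj b\<close> remains.\<close>
    have "\<psi> z * cnj b * (1 - cnj p * z) = (1 - cnj p * z) - cnj a * (\<phi> z * (1 - cnj p * z))"
      unfolding psi[OF z] by (simp add: algebra_simps)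
    also have "\<phi> z * (1 - cnj p * z) = \<mu> * z + a"
      using szego_denom_nonzero[OF p z] by (simp add: phi_eq[OF z])
    also have "1 - cnj p * z - cnj a * (\<mu> * z + a) = b * cnj b"
      by (simp add: bb p_def algebra_simps)
    finally have "\<psi> z * (1 - cnj p * z) = b" using b0 by simp
    then have "\<psi> z = b / (1 - cnj p * z)" using szego_denom_nonzero[OF p z] by (simp add: field_simps)
    then show "\<psi> z = psi_p (b / s) p z" using s(1) by (simp add: psi_p_def s_def[symmetric])
  qed
qed

section \<open>Weighted composition with disk automorphisms\<close>

text \<open>The Taylor series converges at a point beyond 1, hence absolutely at 1. Its terms are
  eventually below 1, where squaring makes them smaller. The Moebius expressions below are all
  handled by this criterion.\<close>

lemma hardy_if_holomorphic_beyond: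
  assumes f: "f holomorphic_on ball 0 R" and R: "1 < R"
  shows "hardy f"
proof -
  obtain r where r: "1 < r" "r < R" using R dense by blast
  have "(\<lambda>n. taylor_coeff f n * complex_of_real r ^ n) sums f (complex_of_real r)"
    using holomorphic_power_series[OF f, of "complex_of_real r"] r by (simp add: taylor_coeff_def)
  then have "summable (\<lambda>n. taylor_coeff f n * complex_of_real r ^ n)" by (rule sums_summable)
  from powser_insidea[OF this, of 1] r have s: "summable (\<lambda>n. cmod (taylor_coeff f n))" by simp
  have "summable (\<lambda>n. (cmod (taylor_coeff f n))\<^sup>2)"
  proof (rule summable_comparison_test_ev[OF _ s])
    have "\<forall>\<^sub>F n in sequentially. cmod (taylor_coeff f n) < 1"
      using summable_LIMSEQ_zero[OF s] by (rule order_tendstoD) simp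
    then show "\<forall>\<^sub>F n in sequentially. norm ((cmod (taylor_coeff f n))\<^sup>2) \<le> cmod (taylor_coeff f n)"
      by eventually_elim (simp add: power2_eq_square mult_left_le)
  qed
  moreover have "f holomorphic_on unit_disk"
    using f R by (rule_tac holomorphic_on_subset) auto
  ultimately show ?thesis by (simp add: hardy_def)
qed

text \<open>Since the shift preserves norms, both squared norms expand to the same three terms. This
  is the Hilbert space form of \<open>cmod (p - z) = cmod (1 - cnj p * z)\<close> on the unit
  circle.\<close>

lemma H2_norm_Blaschke_numerator:
  assumes "hardy g"
  shows "H2_norm (\<lambda>z. (p - z) * g z) = H2_norm (\<lambda>z. (1 - cnj p * z) * g z)"
proof -
  let ?zg = "\<lambda>z. z * g z"
  note h = assms hardy_mult_id[OF assms]
  have "(H2_norm ?zg)\<^sup>2 = (H2_norm g)\<^sup>2"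
    using H2_inner_mult_id[OF assms assms] h by (simp only: H2_inner_self of_real_eq_iff)
  then have nz: "H2_norm ?zg = H2_norm g"
    using h by (simp add: power2_eq_iff_nonneg H2_norm_nonneg)
  have e: "H2_inner (\<lambda>z. p * g z) ?zg = H2_inner g (\<lambda>z. cnj p * ?zg z)"
    using h by (simp add: H2_inner_cmult_left H2_inner_cmult_right)
  have "(H2_norm (\<lambda>z. p * g z - ?zg z))\<^sup>2 = (H2_norm (\<lambda>z. g z - cnj p * ?zg z))\<^sup>2"
    unfolding H2_norm_diff_power2[OF hardy_cmult[OF h(1)] h(2)] H2_norm_diff_power2[OF h(1) hardy_cmult[OF h(2)]] e
    using h by (simp add: H2_norm_cmult nz)
  then have "H2_norm (\<lambda>z. p * g z - ?zg z) = H2_norm (\<lambda>z. g z - cnj p * ?zg z)"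
    using h by (simp add: power2_eq_iff_nonneg H2_norm_nonneg hardy_diff hardy_cmult)
  then show ?thesis by (simp add: algebra_simps)
qed

definition disk_aut :: "complex \<Rightarrow> complex \<Rightarrow> complex \<Rightarrow> complex"
  where "disk_aut lam p z = lam * ((p - z) / (1 - cnj p * z))"

lemma disk_aut_in_disk:
  assumes "p \<in> unit_disk" "cmod lam = 1" "z \<in> unit_disk"
  shows "disk_aut lam p z \<in> unit_disk"
  using Moebius_function_norm_lt_1[of p z 0] assms
  by (simp add: disk_aut_def Moebius_function_def norm_mult norm_divide norm_minus_commute)

text \<open>The radius exceeds 1 but not the modulus \<open>1 / cmod p\<close> of the pole, and
  unlike the latter it also makes sense for \<open>p = 0\<close>.\<close>

lemma disk_aut_denom:
  assumes "p \<in> unit_disk" "z \<in> ball 0 (2 / (1 + cmod p))"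
  shows "1 - cnj p * z \<noteq> 0"
proof
  assume "1 - cnj p * z = 0"
  then have "cmod (cnj p * z) = 1" by (metis eq_iff_diff_eq_0 norm_one)
  then have 1: "cmod p * cmod z = 1" by (simp add: norm_mult)
  have "cmod z * (1 + cmod p) < 2" using assms(2) by (simp add: field_simps add_pos_nonneg)
  then have "cmod z < 1" using 1 by (simp add: algebra_simps)
  then have "cmod p * cmod z < 1 * 1"
    using assms(1) by (intro mult_strict_mono') auto
  then show False using 1 by simp
qed

lemma disk_aut_holomorphic:
  assumes "p \<in> unit_disk"
  shows "disk_aut lam p holomorphic_on ball 0 (2 / (1 + cmod p))"
    and "psi_p c p holomorphic_on ball 0 (2 / (1 + cmod p))"
    and "1 < 2 / (1 + cmod p)"
  unfolding disk_aut_def[abs_def] psi_p_def[abs_def]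
  using assms disk_aut_denom[OF assms]
  by (auto intro!: holomorphic_intros simp: field_simps add_pos_nonneg)

lemma sqrt_disk:
  assumes "p \<in> unit_disk"
  shows "complex_of_real (sqrt (1 - (cmod p)\<^sup>2)) * complex_of_real (sqrt (1 - (cmod p)\<^sup>2)) = 1 - cnj p * p"
proof -
  have "0 \<le> 1 - (cmod p)\<^sup>2" using assms by (simp add: abs_square_le_1)
  then have "complex_of_real (sqrt (1 - (cmod p)\<^sup>2)) * complex_of_real (sqrt (1 - (cmod p)\<^sup>2))
      = complex_of_real (1 - (cmod p)\<^sup>2)"
    by (simp only: of_real_mult[symmetric] real_sqrt_mult_self abs_of_nonneg)
  also have "\<dots> = 1 - cnj p * p" by (simp add: complex_norm_square mult.commute del: of_real_power)
  finally show ?thesis .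
qed

text \<open>Writing \<open>f\<close> as \<open>(1 - cnj p * z) * g z\<close> on the disk reduces
  this to the two numerators. Holomorphy of \<open>f\<close> on the larger disk makes the quotient
  \<open>g\<close> satisfy \<open>hardy\<close>.\<close>

lemma disk_aut_mult_isometric:
  assumes p: "p \<in> unit_disk" and lam: "cmod lam = 1"
    and f: "f holomorphic_on ball 0 (2 / (1 + cmod p))"
  shows "H2_norm (\<lambda>z. disk_aut lam p z * f z) = H2_norm f"
proof -
  let ?B = "ball 0 (2 / (1 + cmod p)) :: complex set"
  define g where "g z = f z / (1 - cnj p * z)" for z
  have "g holomorphic_on ?B"
    unfolding g_def[abs_def] using f disk_aut_denom[OF p] by (intro holomorphic_intros) auto
  then have hg: "hardy g" using disk_aut_holomorphic(3)[OF p] by (rule hardy_if_holomorphic_beyond)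
  have pg: "hardy (\<lambda>z. (p - z) * g z)"
    using hardy_diff[OF hardy_cmult[OF hg, of p] hardy_mult_id[OF hg]] by (simp add: left_diff_distrib)
  have "H2_norm (\<lambda>z. disk_aut lam p z * f z) = H2_norm (\<lambda>z. lam * ((p - z) * g z))"
    by (simp add: disk_aut_def g_def mult_ac)
  also have "\<dots> = H2_norm (\<lambda>z. (p - z) * g z)" using pg lam by (simp add: H2_norm_cmult)
  also have "\<dots> = H2_norm (\<lambda>z. (1 - cnj p * z) * g z)" by (rule H2_norm_Blaschke_numerator[OF hg])
  also have "\<dots> = H2_norm f"
  proof (rule H2_norm_cong)
    show "(1 - cnj p * z) * g z = f z" if "z \<in> unit_disk" for z
      using szego_denom_nonzero[OF p that] by (simp add: g_def)
  qed
  finally show ?thesis .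
qed

lemma psi_p_eq_szego:
  "psi_p c p = (\<lambda>z. (c * complex_of_real (sqrt (1 - (cmod p)\<^sup>2))) * szego p z)"
  by (simp add: psi_p_def szego_def fun_eq_iff)

text \<open>By the reproducing property, the squared norm of the kernel at \<open>p\<close> is its
  value at \<open>p\<close>, namely \<open>1 / (1 - cnj p * p)\<close>.\<close>

lemma H2_norm_psi_p:
  assumes p: "p \<in> unit_disk" and c: "cmod c = 1"
  shows "H2_norm (psi_p c p) = 1"
proof -
  let ?s = "sqrt (1 - (cmod p)\<^sup>2)"
  have s: "0 \<le> 1 - (cmod p)\<^sup>2" using p by (simp add: abs_square_le_1)
  have h: "hardy (szego p)" using p by (rule hardy_szego)
  have ne: "1 - cnj p * p \<noteq> 0" by (rule szego_denom_nonzero[OF p p])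
  have "complex_of_real ((H2_norm (szego p))\<^sup>2) = 1 / (1 - cnj p * p)"
    using szego_reproducing[OF h p] H2_inner_self[OF h] by (simp add: szego_def)
  then have "complex_of_real (?s * ?s * (H2_norm (szego p))\<^sup>2) = 1"
    unfolding of_real_mult sqrt_disk[OF p] using ne by simp
  then have "?s * ?s * (H2_norm (szego p))\<^sup>2 = 1" using of_real_eq_1_iff by blast
  then have "(?s * H2_norm (szego p))\<^sup>2 = 1\<^sup>2" by (simp add: power2_eq_square mult_ac)
  then have "?s * H2_norm (szego p) = 1"
    using s H2_norm_nonneg[OF h] by (subst (asm) power2_eq_iff_nonneg) auto
  then show ?thesis
    unfolding psi_p_eq_szego using s c by (simp add: H2_norm_cmult[OF h] norm_mult)
qed

text \<open>The product vanishes at \<open>p\<close>, and \<open>psi_p c p\<close> is a multiple of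
  the kernel at \<open>p\<close>.\<close>

lemma disk_aut_mult_orthogonal:
  assumes p: "p \<in> unit_disk" and h: "hardy (\<lambda>z. disk_aut lam p z * f z)"
  shows "H2_inner (psi_p c p) (\<lambda>z. disk_aut lam p z * f z) = 0"
proof -
  have "H2_inner (\<lambda>z. disk_aut lam p z * f z) (szego p) = 0"
    using szego_reproducing[OF h p] by (simp add: disk_aut_def)
  then have "H2_inner (szego p) (\<lambda>z. disk_aut lam p z * f z) = 0"
    using H2_inner_cnj[OF h hardy_szego[OF p]] by simp
  then show ?thesis
    unfolding psi_p_eq_szego by (simp add: H2_inner_cmult_left[OF hardy_szego[OF p] h])
qed

text \<open>Orthonormality of the functions \<open>\<phi>\<^sup>n \<psi>\<close>, stated as a
  Pythagorean identity for finite combinations.\<close>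

lemma weighted_moebius_polynomial_norm:
  assumes p: "p \<in> unit_disk" and lam: "cmod lam = 1" and c: "cmod c = 1"
  shows "(\<lambda>z. \<Sum>n<N. a n * disk_aut lam p z ^ n * psi_p c p z) holomorphic_on ball 0 (2 / (1 + cmod p))"
    and "(H2_norm (\<lambda>z. \<Sum>n<N. a n * disk_aut lam p z ^ n * psi_p c p z))\<^sup>2 = (\<Sum>n<N. (cmod (a n))\<^sup>2)"
proof -
  let ?B = "ball 0 (2 / (1 + cmod p)) :: complex set"
  let ?F = "\<lambda>a N z. \<Sum>n<N. a n * disk_aut lam p z ^ n * psi_p c p z"
  have hol: "?F a N holomorphic_on ?B" for a N
    by (intro holomorphic_intros disk_aut_holomorphic p)
  then show "?F a N holomorphic_on ?B" .
  note H = hardy_if_holomorphic_beyond[OF _ disk_aut_holomorphic(3)[OF p]]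
  show "(H2_norm (?F a N))\<^sup>2 = (\<Sum>n<N. (cmod (a n))\<^sup>2)"
  proof (induction N arbitrary: a)
    case 0
    have "(\<lambda>z. 0) = taylor_poly a 0" by (simp add: taylor_poly_def disk_restrict_def)
    then show ?case using H2_norm_taylor_poly[of a 0] by simp
  next
    case (Suc N)
    let ?G = "?F (\<lambda>n. a (Suc n)) N"
    have h1: "hardy (psi_p c p)" by (rule H[OF disk_aut_holomorphic(2)[OF p]])
    have h2: "hardy (\<lambda>z. disk_aut lam p z * ?G z)"
      by (rule H) (intro holomorphic_intros disk_aut_holomorphic p)
    have "?F a (Suc N) = (\<lambda>z. a 0 * psi_p c p z + disk_aut lam p z * ?G z)"
      by (simp add: sum.lessThan_Suc_shift sum_distrib_left mult_ac del: sum.lessThan_Suc)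
    then have "(H2_norm (?F a (Suc N)))\<^sup>2
        = (cmod (a 0) * H2_norm (psi_p c p))\<^sup>2 + (H2_norm (\<lambda>z. disk_aut lam p z * ?G z))\<^sup>2
          + 2 * Re (a 0 * H2_inner (psi_p c p) (\<lambda>z. disk_aut lam p z * ?G z))"
      using h1 h2
      by (simp only: H2_norm_add_power2 hardy_cmult H2_norm_cmult H2_inner_cmult_left)
    also have "\<dots> = (cmod (a 0))\<^sup>2 + (H2_norm ?G)\<^sup>2"
      by (simp only: H2_norm_psi_p[OF p c] disk_aut_mult_isometric[OF p lam hol]
          disk_aut_mult_orthogonal[OF p h2]) simp
    also have "\<dots> = (\<Sum>n<Suc N. (cmod (a n))\<^sup>2)"
      by (simp only: Suc.IH sum.lessThan_Suc_shift)
    finally show ?case .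
  qed
qed

text \<open>By compactness \<open>\<phi>\<close> maps the closed disk of radius 1/2 into a disk of
  radius \<open>\<rho> < 1\<close>, where the Taylor series of \<open>f\<close> converges uniformly.
  A neighbourhood of 0 suffices, since only derivatives at 0 are taken afterwards.\<close>

lemma taylor_partial_sums_compose_uniform_limit:
  assumes f: "f holomorphic_on unit_disk" and phi: "\<phi> holomorphic_on unit_disk" "\<phi> ` unit_disk \<subseteq> unit_disk"
    and psi: "\<psi> holomorphic_on unit_disk"
  shows "uniform_limit (ball 0 (1/2)) (\<lambda>N z. \<Sum>n<N. taylor_coeff f n * \<phi> z ^ n * \<psi> z)
           (\<lambda>z. f (\<phi> z) * \<psi> z) sequentially"
proof -
  let ?K = "cball 0 (1/2) :: complex set"
  have K: "?K \<subseteq> unit_disk" by auto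
  have cont: "continuous_on ?K g" if "g holomorphic_on unit_disk" for g
    using holomorphic_on_imp_continuous_on[OF that] K by (rule continuous_on_subset)
  have "compact (\<phi> ` ?K)" by (intro compact_continuous_image cont phi) simp
  from compact_attains_sup[OF compact_continuous_image[OF continuous_on_norm_id this]]
  obtain x where x: "x \<in> ?K" and max: "\<And>y. y \<in> ?K \<Longrightarrow> cmod (\<phi> y) \<le> cmod (\<phi> x)"
    by auto
  define \<rho> where "\<rho> = cmod (\<phi> x)"
  have "\<phi> x \<in> unit_disk" using x K phi(2) by blast
  then have rho: "\<rho> < 1" by (simp add: \<rho>_def)
  have "1 \<le> conv_radius (taylor_coeff f)"
  proof (rule conv_radius_geI_ex')
    fix r assume "0 < r" "ereal r < 1"
    then show "summable (\<lambda>n. taylor_coeff f n * of_real r ^ n)"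
      using taylor_coeff_sums[OF f, of "of_real r"] by (auto simp: sums_iff)
  qed
  moreover have "ereal \<rho> < 1" using rho by simp
  ultimately have "ereal \<rho> < conv_radius (taylor_coeff f)" by (rule less_le_trans[rotated])
  from powser_uniform_limit[OF this, of 0]
  have "uniform_limit (cball 0 \<rho>) (\<lambda>N w. \<Sum>n<N. taylor_coeff f n * w ^ n)
      (\<lambda>w. \<Sum>n. taylor_coeff f n * w ^ n) sequentially" by simp
  also have "?this \<longleftrightarrow> uniform_limit (cball 0 \<rho>) (\<lambda>N w. \<Sum>n<N. taylor_coeff f n * w ^ n) f sequentially"
  proof (rule uniform_limit_cong)
    show "(\<Sum>n. taylor_coeff f n * w ^ n) = f w" if "w \<in> cball 0 \<rho>" for w
      using taylor_coeff_sums[OF f, of w] that rho by (simp add: sums_iff)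
  qed simp
  finally have "uniform_limit ?K (\<lambda>N z. \<Sum>n<N. taylor_coeff f n * \<phi> z ^ n) (\<lambda>z. f (\<phi> z)) sequentially"
    by (rule uniform_limit_compose') (use max in \<open>auto simp: \<rho>_def\<close>)
  then have "uniform_limit ?K (\<lambda>N z. (\<Sum>n<N. taylor_coeff f n * \<phi> z ^ n) * \<psi> z)
      (\<lambda>z. f (\<phi> z) * \<psi> z) sequentially"
  proof (rule uniform_lim_mult[OF _ uniform_limit_const])
    have "(\<lambda>z. f (\<phi> z)) holomorphic_on unit_disk"
      using holomorphic_on_compose_gen[OF phi(1) f phi(2)] by (simp add: comp_def)
    then show "bounded ((\<lambda>z. f (\<phi> z)) ` ?K)"
      by (intro compact_imp_bounded compact_continuous_image cont) auto
    show "bounded (\<psi> ` ?K)"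
      using psi by (intro compact_imp_bounded compact_continuous_image cont) auto
  qed
  then have "uniform_limit ?K (\<lambda>N z. \<Sum>n<N. taylor_coeff f n * \<phi> z ^ n * \<psi> z)
      (\<lambda>z. f (\<phi> z) * \<psi> z) sequentially" by (simp add: sum_distrib_right)
  then show ?thesis by (rule uniform_limit_on_subset) auto
qed

text \<open>The images of the Taylor polynomials converge coefficientwise, and each has squared norm
  at most that of \<open>f\<close>. A Fatou argument on finite sums of squared coefficients gives
  the inequality; equality comes later from the inverse.\<close>

lemma weighted_moebius_contraction:
  assumes p: "p \<in> unit_disk" and lam: "cmod lam = 1" and c: "cmod c = 1" and f: "f \<in> H2"
  defines "g \<equiv> weighted_comp (psi_p c p) (disk_aut lam p) f"
  shows "g \<in> H2 \<and> H2_norm g \<le> H2_norm f"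
proof -
  let ?a = "taylor_coeff f"
  let ?F = "\<lambda>N z. \<Sum>n<N. ?a n * disk_aut lam p z ^ n * psi_p c p z"
  let ?h = "\<lambda>z. f (disk_aut lam p z) * psi_p c p z"
  have fh: "hardy f" using f by (rule H2_hardy)
  have sub: "unit_disk \<subseteq> ball (0::complex) (2 / (1 + cmod p))"
    using disk_aut_holomorphic(3)[OF p] by auto
  note hol = disk_aut_holomorphic(1,2)[OF p, THEN holomorphic_on_subset, OF sub]
  have map: "disk_aut lam p ` unit_disk \<subseteq> unit_disk" using disk_aut_in_disk[OF p lam] by blast
  have hF: "hardy (?F N)" for N
    by (rule hardy_if_holomorphic_beyond[OF weighted_moebius_polynomial_norm(1)[OF p lam c]
          disk_aut_holomorphic(3)[OF p]])
  have hh: "?h holomorphic_on unit_disk"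
    using holomorphic_on_compose_gen[OF hol(1) hardyD1[OF fh] map] hol(2)
    by (auto simp: comp_def intro!: holomorphic_intros)
  have lim: "(\<lambda>N. taylor_coeff (?F N) k) \<longlonglongrightarrow> taylor_coeff ?h k" for k
  proof -
    have u: "uniform_limit (ball 0 (1/2)) ?F ?h sequentially"
      by (rule taylor_partial_sums_compose_uniform_limit[OF hardyD1[OF fh] hol(1) map hol(2)])
    have "?F N holomorphic_on ball 0 (1/2)" for N
      by (rule holomorphic_on_subset[OF hardyD1[OF hF]]) auto
    then have "\<forall>\<^sub>F N in sequentially. ?F N holomorphic_on ball 0 (1/2)" by simp
    from higher_deriv_complex_uniform_limit[OF u this, of 0 k] show ?thesis
      unfolding taylor_coeff_def by (intro tendsto_intros) auto
  qed
  have part: "(\<Sum>k<n. (cmod (taylor_coeff ?h k))\<^sup>2) \<le> (H2_norm f)\<^sup>2" for n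
  proof (rule LIMSEQ_le_const2)
    show "(\<lambda>N. \<Sum>k<n. (cmod (taylor_coeff (?F N) k))\<^sup>2) \<longlonglongrightarrow> (\<Sum>k<n. (cmod (taylor_coeff ?h k))\<^sup>2)"
      by (intro tendsto_intros lim)
    have "(\<Sum>k<n. (cmod (taylor_coeff (?F N) k))\<^sup>2) \<le> (H2_norm f)\<^sup>2" for N
    proof -
      have "(\<Sum>k<n. (cmod (taylor_coeff (?F N) k))\<^sup>2) \<le> (H2_norm (?F N))\<^sup>2"
        unfolding H2_norm_power2[OF hF] by (intro sum_le_suminf hardyD2 hF) auto
      also have "\<dots> = (\<Sum>n<N. (cmod (?a n))\<^sup>2)"
        by (rule weighted_moebius_polynomial_norm(2)[OF p lam c])
      also have "\<dots> \<le> (H2_norm f)\<^sup>2"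
        unfolding H2_norm_power2[OF fh] by (intro sum_le_suminf hardyD2 fh) auto
      finally show ?thesis .
    qed
    then show "\<exists>N0. \<forall>N\<ge>N0. (\<Sum>k<n. (cmod (taylor_coeff (?F N) k))\<^sup>2) \<le> (H2_norm f)\<^sup>2" by blast
  qed
  have s: "summable (\<lambda>k. (cmod (taylor_coeff ?h k))\<^sup>2)"
    by (rule summableI_nonneg_bounded[OF _ part]) simp
  have hhar: "hardy ?h" using hh s by (simp add: hardy_def)
  have geq: "g = disk_restrict ?h"
    by (simp add: g_def weighted_comp_def disk_restrict_def fun_eq_iff)
  have "(H2_norm ?h)\<^sup>2 \<le> (H2_norm f)\<^sup>2"
    unfolding H2_norm_power2[OF hhar] by (rule suminf_le_const[OF s part])
  then have "H2_norm ?h \<le> H2_norm f" by (rule power2_le_imp_le) (rule H2_norm_nonneg[OF fh])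
  then show ?thesis using hhar
    by (simp add: geq disk_restrict_H2 H2_norm_def taylor_coeff_disk_restrict)
qed

section \<open>Inverse and adjoint of a weighted disk automorphism\<close>

lemma cmod_1_cnj: "cmod lam = 1 \<Longrightarrow> lam * cnj lam = 1"
  by (simp add: complex_norm_square[symmetric])

lemma weighted_comp_cong:
  assumes "\<And>z. z \<in> unit_disk \<Longrightarrow> \<psi> z = \<psi>' z" "\<And>z. z \<in> unit_disk \<Longrightarrow> \<phi> z = \<phi>' z"
  shows "weighted_comp \<psi> \<phi> = weighted_comp \<psi>' \<phi>'"
  using assms by (auto simp: weighted_comp_def fun_eq_iff)

text \<open>The inverse automorphism vanishes at \<open>p * lam\<close>, the image of 0, which
  explains its parameters. The product of the two denominators is constant, and this also makes the
  weights cancel in the next lemma.\<close>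

lemma disk_aut_denom_moebius:
  assumes p: "p \<in> unit_disk" and lam': "cmod lam = 1" and z: "z \<in> unit_disk"
  shows "(1 - cnj (p * lam) * z) * (1 - cnj p * disk_aut (cnj lam) (p * lam) z) = 1 - cnj p * p"
    and "disk_aut lam p (disk_aut (cnj lam) (p * lam) z) = z"
proof -
  note lam = cmod_1_cnj[OF lam']
  have pl: "p * lam \<in> unit_disk" using p lam' by (simp add: norm_mult)
  define D where "D = 1 - cnj (p * lam) * z"
  define w where "w = disk_aut (cnj lam) (p * lam) z"
  have D: "D \<noteq> 0" unfolding D_def by (rule szego_denom_nonzero[OF pl z])
  have w: "w \<in> unit_disk" unfolding w_def using pl z lam' by (intro disk_aut_in_disk) auto
  have Dw: "D * w = p - cnj lam * z"
  proof -
    have "w = cnj lam * (p * lam - z) / D" by (simp add: w_def disk_aut_def D_def)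
    then have "D * w = cnj lam * (p * lam - z)" using D by simp
    also have "\<dots> = (lam * cnj lam) * p - cnj lam * z" by (simp add: algebra_simps)
    finally show ?thesis by (simp add: lam)
  qed
  have E: "D * (1 - cnj p * w) = 1 - cnj p * p"
  proof -
    have "D * (1 - cnj p * w) = D - cnj p * (D * w)" by (simp add: algebra_simps)
    then show ?thesis unfolding Dw by (simp add: D_def algebra_simps)
  qed
  then show "(1 - cnj (p * lam) * z) * (1 - cnj p * disk_aut (cnj lam) (p * lam) z) = 1 - cnj p * p"
    by (simp add: D_def w_def)
  have nw: "1 - cnj p * w \<noteq> 0" by (rule szego_denom_nonzero[OF p w])
  have "D * (lam * (p - w)) = lam * (p * D - D * w)" by (simp add: algebra_simps)
  also have "\<dots> = (lam * cnj lam) * z * (1 - cnj p * p)"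
    unfolding Dw by (simp add: D_def algebra_simps)
  also have "\<dots> = D * (z * (1 - cnj p * w))"
    unfolding lam E[symmetric] by (simp add: mult_ac)
  finally have "lam * (p - w) = z * (1 - cnj p * w)" using D by simp
  then have "disk_aut lam p w = z" unfolding disk_aut_def using nw by (simp add: divide_simps)
  then show "disk_aut lam p (disk_aut (cnj lam) (p * lam) z) = z" by (simp add: w_def)
qed

lemma weighted_moebius_inverse_right:
  assumes p: "p \<in> unit_disk" and lam: "cmod lam = 1" and c: "cmod c = 1" and f: "f \<in> H2"
  shows "weighted_comp (psi_p (cnj c) (p * lam)) (disk_aut (cnj lam) (p * lam))
           (weighted_comp (psi_p c p) (disk_aut lam p) f) = f"
proof (rule H2_eqI)
  have pl: "p * lam \<in> unit_disk" using p lam by (simp add: norm_mult)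
  show "weighted_comp (psi_p (cnj c) (p * lam)) (disk_aut (cnj lam) (p * lam))
           (weighted_comp (psi_p c p) (disk_aut lam p) f) \<in> H2"
    using weighted_moebius_contraction p pl lam c f by simp
  fix z :: complex assume z: "z \<in> unit_disk"
  let ?w = "disk_aut (cnj lam) (p * lam) z"
  let ?s = "complex_of_real (sqrt (1 - (cmod p)\<^sup>2))"
  have w: "?w \<in> unit_disk" using pl z lam by (intro disk_aut_in_disk) auto
  have "psi_p (cnj c) (p * lam) z * psi_p c p ?w
      = (c * cnj c) * (?s * ?s) / ((1 - cnj (p * lam) * z) * (1 - cnj p * ?w))"
    using lam by (simp add: psi_p_def norm_mult mult_ac)
  also have "\<dots> = 1"
    unfolding disk_aut_denom_moebius(1)[OF p lam z] sqrt_disk[OF p] cmod_1_cnj[OF c]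
    using szego_denom_nonzero[OF p p] by simp
  finally have 1: "psi_p (cnj c) (p * lam) z * psi_p c p ?w = 1" .
  have "weighted_comp (psi_p (cnj c) (p * lam)) (disk_aut (cnj lam) (p * lam))
           (weighted_comp (psi_p c p) (disk_aut lam p) f) z
     = (psi_p (cnj c) (p * lam) z * psi_p c p ?w) * f (disk_aut lam p ?w)"
    using z w by (simp add: weighted_comp_def mult.assoc)
  then show "weighted_comp (psi_p (cnj c) (p * lam)) (disk_aut (cnj lam) (p * lam))
           (weighted_comp (psi_p c p) (disk_aut lam p) f) z = f z"
    unfolding 1 disk_aut_denom_moebius(2)[OF p lam z] by simp
qed (rule f)

lemma weighted_moebius_inverse_left:
  assumes p: "p \<in> unit_disk" and lam: "cmod lam = 1" and c: "cmod c = 1" and f: "f \<in> H2"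
  shows "weighted_comp (psi_p c p) (disk_aut lam p)
           (weighted_comp (psi_p (cnj c) (p * lam)) (disk_aut (cnj lam) (p * lam)) f) = f"
proof -
  have "p * lam \<in> unit_disk" using p lam by (simp add: norm_mult)
  from weighted_moebius_inverse_right[OF this, of "cnj lam" "cnj c" f] lam c f
  show ?thesis by (simp add: mult.assoc cmod_1_cnj)
qed

text \<open>A contraction whose left inverse is also a contraction preserves norms.\<close>

lemma weighted_moebius_isometry:
  assumes p: "p \<in> unit_disk" and lam: "cmod lam = 1" and c: "cmod c = 1"
  shows "H2_isometry (weighted_comp (psi_p c p) (disk_aut lam p))"
proof -
  let ?T = "weighted_comp (psi_p c p) (disk_aut lam p)"
  have pl: "p * lam \<in> unit_disk" using p lam by (simp add: norm_mult)
  note W = weighted_moebius_contraction[OF p lam c]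
  have norm: "H2_norm (?T f) = H2_norm f" if f: "f \<in> H2" for f
  proof (rule antisym)
    show "H2_norm (?T f) \<le> H2_norm f" using W[OF f] by simp
    show "H2_norm f \<le> H2_norm (?T f)"
      using weighted_moebius_contraction[OF pl, of "cnj lam" "cnj c" "?T f"] lam c W[OF f]
        weighted_moebius_inverse_right[OF p lam c f] by simp
  qed
  have "H2_bounded_operator ?T"
    unfolding H2_bounded_operator_def
  proof (intro conjI)
    show "\<exists>M. \<forall>f\<in>H2. H2_norm (?T f) \<le> M * H2_norm f" using norm by (intro exI[of _ 1]) simp
  qed (use W in \<open>auto simp: weighted_comp_def fun_eq_iff ring_distribs\<close>)
  with norm show ?thesis by (simp add: H2_isometry_def)
qed

text \<open>Writing \<open>g\<close> as \<open>T (S g)\<close> and using that \<open>T\<close>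
  preserves inner products moves \<open>T\<close> off both arguments.\<close>

lemma weighted_moebius_adjoint:
  assumes p: "p \<in> unit_disk" and lam: "cmod lam = 1" and c: "cmod c = 1" and g: "g \<in> H2"
  shows "H2_adjoint (weighted_comp (psi_p c p) (disk_aut lam p)) g
       = weighted_comp (psi_p (cnj c) (p * lam)) (disk_aut (cnj lam) (p * lam)) g"
proof (rule H2_inner_eqI)
  let ?T = "weighted_comp (psi_p c p) (disk_aut lam p)"
  let ?S = "weighted_comp (psi_p (cnj c) (p * lam)) (disk_aut (cnj lam) (p * lam))"
  have pl: "p * lam \<in> unit_disk" using p lam by (simp add: norm_mult)
  note iso = weighted_moebius_isometry[OF p lam c]
  then have bT: "H2_bounded_operator ?T" by (simp add: H2_isometry_def)
  show S: "?S g \<in> H2" using weighted_moebius_contraction[OF pl, of "cnj lam" "cnj c" g] lam c g by simp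
  show "H2_adjoint ?T g \<in> H2" using H2_adjoint(1)[OF bT] g by auto
  fix f assume f: "f \<in> H2"
  have "H2_inner f (H2_adjoint ?T g) = H2_inner (?T f) (?T (?S g))"
    unfolding weighted_moebius_inverse_left[OF p lam c g] using H2_adjoint(2)[OF bT f g] by simp
  also have "\<dots> = H2_inner f (?S g)" by (rule H2_isometry_inner[OF iso f S])
  finally show "H2_inner f (H2_adjoint ?T g) = H2_inner f (?S g)" .
qed

section \<open>Conjugations and complex symmetry\<close>

lemma J_conjugation: "H2_conjugation J"
proof -
  have "J f \<in> H2 \<and> H2_norm (J f) = H2_norm f" if "f \<in> H2" for f
  proof -
    have f: "f holomorphic_on unit_disk" using that by (simp add: H2_hardy hardyD1)
    have "J f holomorphic_on unit_disk" using J_sums[OF f] by (rule sums_imp_holomorphic)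
    with that show ?thesis
      by (simp add: H2_iff hardy_def H2_norm_def taylor_coeff_J[OF f]) (simp add: J_def)
  qed
  then show ?thesis
    by (auto simp: H2_conjugation_def J_def fun_eq_iff)
qed

text \<open>The adjoint is the inverse, so the symmetry condition becomes an identity that can be
  checked by evaluating functions pointwise.\<close>

lemma complex_symmetric_withI:
  assumes p: "p \<in> unit_disk" and lam: "cmod lam = 1" and c: "cmod c = 1"
    and C: "H2_conjugation C"
    and CTCT: "\<And>f. f \<in> H2 \<Longrightarrow> C (weighted_comp (psi_p c p) (disk_aut lam p)
         (C (weighted_comp (psi_p c p) (disk_aut lam p) f))) = f"
  shows "complex_symmetric_with (weighted_comp (psi_p c p) (disk_aut lam p)) C"
proof -
  let ?T = "weighted_comp (psi_p c p) (disk_aut lam p)"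
  let ?S = "weighted_comp (psi_p (cnj c) (p * lam)) (disk_aut (cnj lam) (p * lam))"
  have pl: "p * lam \<in> unit_disk" using p lam by (simp add: norm_mult)
  have TH: "?T f \<in> H2" if "f \<in> H2" for f using weighted_moebius_contraction[OF p lam c that] by simp
  have CH: "C f \<in> H2" and CC: "C (C f) = f" if "f \<in> H2" for f
    using C that by (auto simp: H2_conjugation_def)
  have "C (H2_adjoint ?T (C f)) = ?T f" if f: "f \<in> H2" for f
  proof -
    have "?T (C (?T f)) = C f" using CTCT[OF f] CC[OF TH[OF CH[OF TH[OF f]]]] by simp
    then have "?S (C f) = C (?T f)"
      using weighted_moebius_inverse_right[OF p lam c CH[OF TH[OF f]]] by simp
    then show ?thesis
      using f by (simp add: weighted_moebius_adjoint[OF p lam c] CH CC TH)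
  qed
  then show ?thesis
    using C weighted_moebius_isometry[OF p lam c] by (simp add: complex_symmetric_with_def H2_isometry_def)
qed

lemma phi_p_eq_moebius: "phi_p p = disk_aut (cnj p / p) p"
  by (simp add: phi_p_def disk_aut_def fun_eq_iff)

text \<open>These are the weight and the inner map of the conjugation followed through
  \<open>J\<close> and the operator. The denominators multiply to the constant
  \<open>1 - cnj p * p\<close>, so the weights cancel and the two automorphisms collapse to a
  rotation of \<open>cnj z\<close>.\<close>

lemma psi_p_conj_phi_p:
  assumes p: "p \<in> unit_disk" "p \<noteq> 0" and c: "cmod c = 1" and z: "z \<in> unit_disk"
  shows "psi_p c p z * cnj (psi_p c p (cnj (phi_p p z))) = 1"
    and "disk_aut lam p (cnj (phi_p p z)) = lam * (p / cnj p) * cnj z"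
proof -
  let ?s = "complex_of_real (sqrt (1 - (cmod p)\<^sup>2))"
  let ?D = "1 - cnj p * z"
  define w where "w = phi_p p z"
  have D: "?D \<noteq> 0" by (rule szego_denom_nonzero[OF p(1) z])
  have Dw: "?D * (p * w) = cnj p * (p - z)" using D p(2) by (simp add: w_def phi_p_def)
  have E: "?D * (1 - p * w) = 1 - cnj p * p"
  proof -
    have "?D * (1 - p * w) = ?D - ?D * (p * w)" by (simp add: algebra_simps)
    then show ?thesis unfolding Dw by (simp add: algebra_simps)
  qed
  have s1: "1 - cnj p * p \<noteq> 0" by (rule szego_denom_nonzero[OF p(1) p(1)])
  have nw: "1 - p * w \<noteq> 0" using E s1 by auto
  have "psi_p c p z * cnj (psi_p c p (cnj w)) = (c * cnj c) * (?s * ?s) / (?D * (1 - p * w))"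
    by (simp add: psi_p_def mult_ac)
  also have "\<dots> = 1" unfolding E sqrt_disk[OF p(1)] cmod_1_cnj[OF c] using s1 by simp
  finally show "psi_p c p z * cnj (psi_p c p (cnj (phi_p p z))) = 1" by (simp add: w_def)
  have "p * ?D * (cnj p - w) = cnj p * (p * ?D) - ?D * (p * w)" by (simp add: algebra_simps)
  also have "\<dots> = cnj p * (z * (1 - cnj p * p))" unfolding Dw by (simp add: algebra_simps)
  also have "\<dots> = ?D * (cnj p * z * (1 - p * w))" unfolding E[symmetric] by (simp add: mult_ac)
  finally have "p * (cnj p - w) = cnj p * z * (1 - p * w)" using D by simp
  then have "(cnj p - w) / (1 - p * w) = cnj p / p * z" using nw p(2) by (simp add: field_simps)
  then have "cnj ((cnj p - w) / (1 - p * w)) = p / cnj p * cnj z" by simp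
  then show "disk_aut lam p (cnj (phi_p p z)) = lam * (p / cnj p) * cnj z"
    by (simp add: disk_aut_def w_def[symmetric])
qed

lemma phi_p_conjugation:
  assumes p: "p \<in> unit_disk" "p \<noteq> 0" and c: "cmod c = 1"
  shows "H2_conjugation (weighted_comp (psi_p c p) (phi_p p) \<circ> J)"
    (is "H2_conjugation (?W \<circ> J)")
proof -
  have iso: "H2_isometry ?W"
    unfolding phi_p_eq_moebius using p c by (intro weighted_moebius_isometry) (auto simp: norm_divide)
  have JJ: "J \<in> H2 \<rightarrow> H2" and Jn: "\<And>f. f \<in> H2 \<Longrightarrow> H2_norm (J f) = H2_norm f"
    using J_conjugation by (auto simp: H2_conjugation_def)
  have WH: "?W \<in> H2 \<rightarrow> H2" and Wn: "\<And>f. f \<in> H2 \<Longrightarrow> H2_norm (?W f) = H2_norm f"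
    using iso by (auto simp: H2_isometry_def H2_bounded_operator_def)
  have inv: "?W (J (?W (J f))) = f" if f: "f \<in> H2" for f
  proof (rule H2_eqI)
    show "?W (J (?W (J f))) \<in> H2" using f JJ WH by auto
    fix z :: complex assume z: "z \<in> unit_disk"
    have w: "cnj (phi_p p z) \<in> unit_disk"
      using disk_aut_in_disk[OF p(1) _ z, of "cnj p / p"] p by (simp add: phi_p_eq_moebius norm_divide)
    \<comment> \<open>For \<open>lam = cnj p / p\<close> the rotation factor
      \<open>lam * (p / cnj p)\<close> is 1, so the map is an involution.\<close>
    have "phi_p p (cnj (phi_p p z)) = cnj z"
      using psi_p_conj_phi_p(2)[OF p c z, of "cnj p / p"] p(2) by (simp add: phi_p_eq_moebius)
    then have "?W (J (?W (J f))) z = psi_p c p z * cnj (psi_p c p (cnj (phi_p p z))) * f z"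
      using z w by (simp add: weighted_comp_def J_def)
    then show "?W (J (?W (J f))) z = f z" by (simp add: psi_p_conj_phi_p(1)[OF p c z])
  qed (rule f)
  show ?thesis
    unfolding H2_conjugation_def
    using JJ WH inv by (auto simp: Jn Wn Pi_iff) (auto simp: weighted_comp_def J_def fun_eq_iff ring_distribs)
qed

lemma weighted_moebius_symmetric_with:
  assumes p: "p \<in> unit_disk" "p \<noteq> 0" and lam: "cmod lam = 1" and c: "cmod c = 1"
  shows "complex_symmetric_with (weighted_comp (psi_p c p) (disk_aut lam p))
           (weighted_comp (psi_p c p) (phi_p p) \<circ> J)"
proof (rule complex_symmetric_withI[OF p(1) lam c phi_p_conjugation[OF p c]])
  let ?T = "weighted_comp (psi_p c p) (disk_aut lam p)" and ?C = "weighted_comp (psi_p c p) (phi_p p) \<circ> J"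
  define \<mu> where "\<mu> = lam * (p / cnj p)"
  have mu: "\<mu> * cnj \<mu> = 1" using lam p(2) by (intro cmod_1_cnj) (simp add: \<mu>_def norm_mult norm_divide)
  then have nmu: "cmod \<mu> = 1" using lam p(2) by (simp add: \<mu>_def norm_mult norm_divide)
  fix f assume f: "f \<in> H2"
  \<comment> \<open>Applying this formula twice replaces \<open>z\<close> by
    \<open>\<mu> * cnj \<mu> * z\<close>, which is \<open>z\<close>.\<close>
  have CT: "?C (?T g) z = cnj (g (\<mu> * cnj z))" if z: "z \<in> unit_disk" for g z
  proof -
    have w: "cnj (phi_p p z) \<in> unit_disk"
      using disk_aut_in_disk[OF p(1) _ z, of "cnj p / p"] p by (simp add: phi_p_eq_moebius norm_divide)
    have "?C (?T g) z = (psi_p c p z * cnj (psi_p c p (cnj (phi_p p z)))) * cnj (g (disk_aut lam p (cnj (phi_p p z))))"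
      using z w by (simp add: weighted_comp_def J_def)
    then show ?thesis
      unfolding psi_p_conj_phi_p(1)[OF p c z] psi_p_conj_phi_p(2)[OF p c z] by (simp add: \<mu>_def)
  qed
  have CH: "?C g \<in> H2" if "g \<in> H2" for g
    using phi_p_conjugation[OF p c] that unfolding H2_conjugation_def by blast
  have TH: "?T g \<in> H2" if "g \<in> H2" for g using weighted_moebius_contraction[OF p(1) lam c that] by simp
  show "?C (?T (?C (?T f))) = f"
  proof (rule H2_eqI)
    show "?C (?T (?C (?T f))) \<in> H2" using f by (intro CH TH)
    fix z :: complex assume z: "z \<in> unit_disk"
    then have "\<mu> * cnj z \<in> unit_disk" using nmu by (simp add: norm_mult)
    then have "?C (?T (?C (?T f))) z = f (\<mu> * cnj \<mu> * z)"
      using z by (simp add: CT mult.assoc del: comp_apply)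
    then show "?C (?T (?C (?T f))) z = f z" by (simp only: mu mult_1_left)
  qed (rule f)
qed

text \<open>The case \<open>p = 0\<close>, where \<open>cnj p / p\<close> is 0 in HOL and
  \<open>phi_p\<close> is no automorphism. The operator is a unimodular multiple of a rotation, and
  \<open>J\<close> itself serves as conjugation.\<close>

lemma weighted_rotation_symmetric_with:
  assumes lam: "cmod lam = 1" and c: "cmod c = 1"
  shows "complex_symmetric_with (weighted_comp (psi_p c 0) (disk_aut lam 0)) J"
proof (rule complex_symmetric_withI[OF _ lam c J_conjugation])
  fix f assume f: "f \<in> H2"
  let ?T = "weighted_comp (psi_p c 0) (disk_aut lam 0)"
  have ap: "?T g z = c * g (- (lam * z))" if "z \<in> unit_disk" for g z
    using that by (simp add: weighted_comp_def psi_p_def disk_aut_def)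
  have TH: "?T g \<in> H2" if "g \<in> H2" for g using weighted_moebius_contraction[OF _ lam c that, of 0] by simp
  have JH: "J g \<in> H2" if "g \<in> H2" for g using J_conjugation that by (auto simp: H2_conjugation_def)
  show "J (?T (J (?T f))) = f"
  proof (rule H2_eqI)
    show "J (?T (J (?T f))) \<in> H2" using f by (intro JH TH)
    fix z :: complex assume z: "z \<in> unit_disk"
    then have 1: "cnj z \<in> unit_disk" "- (cnj lam * z) \<in> unit_disk" using lam by (auto simp: norm_mult)
    have "J (?T (J (?T f))) z = (c * cnj c) * f ((lam * cnj lam) * z)"
      using 1 by (simp add: J_def ap mult_ac)
    then show "J (?T (J (?T f))) z = f z" by (simp add: cmod_1_cnj lam c)
  qed (rule f)
qed simp

theorem theorem2p7:
  fixes \<phi> \<psi> :: "complex \<Rightarrow> complex"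
  assumes "\<phi> holomorphic_on unit_disk" and "\<phi> ` unit_disk \<subseteq> unit_disk"
    and "\<psi> holomorphic_on unit_disk"
  shows "(H2_isometry (weighted_comp \<psi> \<phi>) \<and> complex_symmetric (weighted_comp \<psi> \<phi>) \<longleftrightarrow>
          (\<exists>p lam c. p \<in> unit_disk \<and> cmod lam = 1 \<and> cmod c = 1 \<and>
             (\<forall>z\<in>unit_disk. \<phi> z = lam * ((p - z) / (1 - cnj p * z))) \<and>
             (\<forall>z\<in>unit_disk. \<psi> z = psi_p c p z)))
       \<and> (\<forall>p lam c. p \<in> unit_disk \<and> cmod lam = 1 \<and> cmod c = 1 \<and>
             (\<forall>z\<in>unit_disk. \<phi> z = lam * ((p - z) / (1 - cnj p * z))) \<and>
             (\<forall>z\<in>unit_disk. \<psi> z = psi_p c p z) \<and> p \<noteq> 0 \<longrightarrow>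
             complex_symmetric_with (weighted_comp \<psi> \<phi>)
               (weighted_comp (psi_p c p) (phi_p p) \<circ> J))"
    (is "(?L \<longleftrightarrow> (\<exists>p lam c. ?R p lam c)) \<and> _")
proof (intro conjI allI impI iffI)
  \<comment> \<open>The formulas hold on the disk only, which is where \<open>weighted_comp\<close>
    evaluates the weight and the inner map.\<close>
  have eq: "weighted_comp \<psi> \<phi> = weighted_comp (psi_p c p) (disk_aut lam p)" if "?R p lam c" for p lam c
    using that by (intro weighted_comp_cong) (auto simp: disk_aut_def)
  {
    assume ?L
    then show "\<exists>p lam c. ?R p lam c"
      by (intro weighted_kernel_identity_imp_moebius isometric_complex_symmetric_kernel assms) auto
  next
    assume "\<exists>p lam c. ?R p lam c"
    then obtain p lam c where R: "?R p lam c" by blast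
    then have "H2_isometry (weighted_comp \<psi> \<phi>)"
      unfolding eq[OF R] by (intro weighted_moebius_isometry) auto
    moreover have "complex_symmetric (weighted_comp \<psi> \<phi>)"
      unfolding eq[OF R] complex_symmetric_def
      using R weighted_moebius_symmetric_with[of p lam c] weighted_rotation_symmetric_with[of lam c]
      by (cases "p = 0") blast+
    ultimately show "H2_isometry (weighted_comp \<psi> \<phi>)" "complex_symmetric (weighted_comp \<psi> \<phi>)"
      by auto
  next
    fix p lam c
    assume A: "p \<in> unit_disk \<and> cmod lam = 1 \<and> cmod c = 1 \<and>
             (\<forall>z\<in>unit_disk. \<phi> z = lam * ((p - z) / (1 - cnj p * z))) \<and>
             (\<forall>z\<in>unit_disk. \<psi> z = psi_p c p z) \<and> p \<noteq> 0"
    then have R: "?R p lam c" by blast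
    show "complex_symmetric_with (weighted_comp \<psi> \<phi>)
               (weighted_comp (psi_p c p) (phi_p p) \<circ> J)"
      unfolding eq[OF R] using A by (intro weighted_moebius_symmetric_with) auto
  }
qed

end
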